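(* Let $K$ be a (non-empty) compact Hausdorff space, $X$ a real Banach space and $\tau$ an infinite cardinal. If $\mathrm{cf}(\tau) > \mathrm{w}(K)$, then $C(K,X)$ contains a complemented copy of $c_0(\tau)$ if and only if $X$ contains a complemented copy of $c_0(\tau)$.
   Context: All Banach spaces are real. $C(K,X)$ is the Banach space of all continuous $X$-valued functions on $K$ with the supremum norm. For a non-empty set $\Gamma$, $c_0(\Gamma)$ is the Banach space of all real-valued maps $f$ on $\Gamma$ such that for each $\varepsilon>0$ the set $\{\gamma\in\Gamma : |f(\gamma)|\ge\varepsilon\}$ is finite, with the supremum norm; $c_0(\tau)$ denotes $c_0(\Gamma)$ for $\Gamma$ of cardinality $\tau$ (one may take $\Gamma=\tau$). A Banach space $Y$ contains a complemented copy of a Banach space $Z$ if $Z$ is isomorphic (linearly homeomorphic) to a complemented subspace of $Y$, that is, to a closed subspace of $Y$ which is the range of a bounded linear projection on $Y$. The cofinality $\mathrm{cf}(\tau)$ is the least cardinal $\alpha$ such that there is a family of ordinals $\{\beta_i : i\in\alpha\}$ with $\beta_i<\tau$ for all $i\in\alpha$ and $\sup\{\beta_i : i\in\alpha\}=\tau$. The weight $\mathrm{w}(K)$ is the least cardinality of an open topological basis of $K$ (it is finite when $K$ is finite). *)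

theory Defs
  imports "HOL-Analysis.Analysis"
begin

unbundle cardinal_syntax

section \<open>Weight and cofinality\<close>

text \<open>For a finite space a smallest base is finite, so the weight need not be infinite.\<close>

definition weight :: "'k::topological_space itself \<Rightarrow> 'k set rel" where
  "weight k = |SOME B :: 'k set set. topological_basis B \<and>
                 (\<forall>B' :: 'k set set. topological_basis B' \<longrightarrow> |B| \<le>o |B'| )|"

text \<open>
  The elements of \<^term>\<open>Field r\<close> are the ordinals below the cardinal \<^term>\<open>r\<close>, and
  \<^const>\<open>BNF_Cardinal_Order_Relation.cofinal\<close> says that every element of \<^term>\<open>Field r\<close> is
  strictly below some member of the family, i.e. that the supremum of the family is \<^term>\<open>r\<close>
  itself.
\<close>

definition has_cofinal_family :: "'c rel \<Rightarrow> 'i rel \<Rightarrow> bool" where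
  "has_cofinal_family r a \<longleftrightarrow>
     (\<exists>\<beta>. (\<forall>i\<in>Field a. \<beta> i \<in> Field r) \<and>
          BNF_Cardinal_Order_Relation.cofinal (\<beta> ` Field a) r)"

text \<open>
  Index cardinals on the type underlying \<^term>\<open>r\<close> suffice, since an infinite cardinal
  \<^term>\<open>r\<close> has a cofinal family indexed by \<^term>\<open>r\<close> itself.
\<close>

definition cofinality :: "'c rel \<Rightarrow> 'c rel" where
  "cofinality r = (SOME a. Card_order a \<and> has_cofinal_family r a \<and>
                     (\<forall>a' :: 'c rel. Card_order a' \<and> has_cofinal_family r a' \<longrightarrow> a \<le>o a'))"

lemma weight_least:
  shows "\<exists>B :: 'k::topological_space set set. topological_basis B \<and> weight TYPE('k) = |B|"
    and "topological_basis (B' :: 'k set set) \<Longrightarrow> weight TYPE('k) \<le>o |B'|"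
proof -
  let ?R = "{ |B| | B :: 'k set set. topological_basis B}"
  have "topological_basis {S :: 'k set. open S}"
    unfolding topological_basis_def by (auto intro!: exI[of _ "{_}"])
  then have "?R \<noteq> {}" by blast
  moreover have "\<forall>r\<in>?R. Card_order r" using card_of_Card_order by blast
  ultimately have "\<exists>r\<in>?R. \<forall>r'\<in>?R. r \<le>o r'"
    by (rule exists_minim_Card_order)
  then have "\<exists>B :: 'k set set. topological_basis B \<and>
               (\<forall>B' :: 'k set set. topological_basis B' \<longrightarrow> |B| \<le>o |B'| )"
    by blast
  from someI_ex[OF this]
  show "\<exists>B :: 'k set set. topological_basis B \<and> weight TYPE('k) = |B|"
    and "topological_basis (B' :: 'k set set) \<Longrightarrow> weight TYPE('k) \<le>o |B'|"
    unfolding weight_def by blast+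
qed

lemma cofinality_least:
  fixes r :: "'c rel"
  assumes "Card_order r" "infinite (Field r)"
  shows "Card_order (cofinality r)"
    and "has_cofinal_family r (cofinality r)"
    and "\<And>a :: 'c rel. Card_order a \<Longrightarrow> has_cofinal_family r a \<Longrightarrow> cofinality r \<le>o a"
proof -
  let ?R = "{a :: 'c rel. Card_order a \<and> has_cofinal_family r a}"
  have "BNF_Cardinal_Order_Relation.cofinal (Field r) r"
    unfolding BNF_Cardinal_Order_Relation.cofinal_def
    using infinite_Card_order_limit[OF assms] by blast
  then have "has_cofinal_family r r"
    unfolding has_cofinal_family_def by (auto intro!: exI[of _ id])
  with assms have "?R \<noteq> {}" by blast
  moreover have "\<forall>a\<in>?R. Card_order a" by auto
  ultimately have "\<exists>a\<in>?R. \<forall>a'\<in>?R. a \<le>o a'"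
    by (rule exists_minim_Card_order)
  then have "\<exists>a :: 'c rel. Card_order a \<and> has_cofinal_family r a \<and>
               (\<forall>a' :: 'c rel. Card_order a' \<and> has_cofinal_family r a' \<longrightarrow> a \<le>o a')"
    by auto
  from someI_ex[OF this]
  have "Card_order (cofinality r) \<and> has_cofinal_family r (cofinality r) \<and>
      (\<forall>a' :: 'c rel. Card_order a' \<and> has_cofinal_family r a' \<longrightarrow> cofinality r \<le>o a')"
    unfolding cofinality_def .
  then show "Card_order (cofinality r)" "has_cofinal_family r (cofinality r)"
    and "\<And>a :: 'c rel. Card_order a \<Longrightarrow> has_cofinal_family r a \<Longrightarrow> cofinality r \<le>o a"
    by simp_all
qed

section \<open>The Banach space of null functions on an index type\<close>

typedef 'g c0 = "{f :: 'g \<Rightarrow> real. \<forall>e>0. finite {x. \<bar>f x\<bar> \<ge> e}}"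
  morphisms apply_c0 Abs_c0
  by (rule exI[of _ "\<lambda>_. 0"]) auto

setup_lifting type_definition_c0

lemma c0_eqI: "(\<And>x. apply_c0 f x = apply_c0 g x) \<Longrightarrow> f = g"
  by transfer auto

lemma finite_c0: "e > 0 \<Longrightarrow> finite {x. \<bar>apply_c0 f x\<bar> \<ge> e}"
  by transfer auto

lemma bdd_above_c0: "bdd_above (range (\<lambda>x. \<bar>apply_c0 f x\<bar>))"
proof -
  let ?A = "{x. \<bar>apply_c0 f x\<bar> \<ge> 1}"
  have "bdd_above ((\<lambda>x. \<bar>apply_c0 f x\<bar>) ` ?A)"
    by (intro bdd_above_finite finite_imageI finite_c0) simp
  moreover have "bdd_above ((\<lambda>x. \<bar>apply_c0 f x\<bar>) ` (- ?A))"
    by (rule bdd_aboveI[of _ 1]) auto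
  ultimately have "bdd_above ((\<lambda>x. \<bar>apply_c0 f x\<bar>) ` (?A \<union> - ?A))"
    unfolding image_Un by simp
  then show ?thesis by (simp add: Compl_partition)
qed

instantiation c0 :: (type) real_vector
begin

lift_definition zero_c0 :: "'a c0" is "\<lambda>_. 0" by simp

lift_definition plus_c0 :: "'a c0 \<Rightarrow> 'a c0 \<Rightarrow> 'a c0" is "\<lambda>f g x. f x + g x"
proof -
  fix f g :: "'a \<Rightarrow> real" and e :: real
  assume *: "\<And>e. e > 0 \<Longrightarrow> finite {x. \<bar>f x\<bar> \<ge> e}" "\<And>e. e > 0 \<Longrightarrow> finite {x. \<bar>g x\<bar> \<ge> e}" "e > 0"
  have "{x. \<bar>f x + g x\<bar> \<ge> e} \<subseteq> {x. \<bar>f x\<bar> \<ge> e/2} \<union> {x. \<bar>g x\<bar> \<ge> e/2}" by auto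
  then show "finite {x. \<bar>f x + g x\<bar> \<ge> e}"
    by (rule finite_subset) (use *(1,2)[of "e/2"] *(3) in simp)
qed

lift_definition uminus_c0 :: "'a c0 \<Rightarrow> 'a c0" is "\<lambda>f x. - f x" by simp

lift_definition minus_c0 :: "'a c0 \<Rightarrow> 'a c0 \<Rightarrow> 'a c0" is "\<lambda>f g x. f x - g x"
proof -
  fix f g :: "'a \<Rightarrow> real" and e :: real
  assume *: "\<And>e. e > 0 \<Longrightarrow> finite {x. \<bar>f x\<bar> \<ge> e}" "\<And>e. e > 0 \<Longrightarrow> finite {x. \<bar>g x\<bar> \<ge> e}" "e > 0"
  have "{x. \<bar>f x - g x\<bar> \<ge> e} \<subseteq> {x. \<bar>f x\<bar> \<ge> e/2} \<union> {x. \<bar>g x\<bar> \<ge> e/2}" by auto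
  then show "finite {x. \<bar>f x - g x\<bar> \<ge> e}"
    by (rule finite_subset) (use *(1,2)[of "e/2"] *(3) in simp)
qed

lift_definition scaleR_c0 :: "real \<Rightarrow> 'a c0 \<Rightarrow> 'a c0" is "\<lambda>c f x. c * f x"
proof -
  fix f :: "'a \<Rightarrow> real" and c e :: real
  assume *: "\<And>e. e > 0 \<Longrightarrow> finite {x. \<bar>f x\<bar> \<ge> e}" "e > 0"
  show "finite {x. \<bar>c * f x\<bar> \<ge> e}"
  proof (cases "c = 0")
    case False
    then have "{x. \<bar>c * f x\<bar> \<ge> e} = {x. \<bar>f x\<bar> \<ge> e / \<bar>c\<bar>}"
      by (auto simp: abs_mult field_simps)
    with * False show ?thesis by simp
  qed (use * in auto)
qed

instance
proof
  fix f g h :: "'a c0" and a b :: real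
  show "f + g + h = f + (g + h)" by transfer (simp add: ac_simps)
  show "f + g = g + f" by transfer (simp add: ac_simps)
  show "0 + f = f" by transfer simp
  show "- f + f = 0" by transfer simp
  show "f - g = f + - g" by transfer simp
  show "a *\<^sub>R (f + g) = a *\<^sub>R f + a *\<^sub>R g" by transfer (simp add: algebra_simps)
  show "(a + b) *\<^sub>R f = a *\<^sub>R f + b *\<^sub>R f" by transfer (simp add: algebra_simps)
  show "a *\<^sub>R b *\<^sub>R f = (a * b) *\<^sub>R f" by transfer (simp add: algebra_simps)
  show "1 *\<^sub>R f = f" by transfer simp
qed

end

instantiation c0 :: (type) real_normed_vector
begin

lift_definition norm_c0 :: "'a c0 \<Rightarrow> real" is "\<lambda>f. SUP x. \<bar>f x\<bar>" .

definition dist_c0 :: "'a c0 \<Rightarrow> 'a c0 \<Rightarrow> real" where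
  "dist_c0 f g = norm (f - g)"

definition sgn_c0 :: "'a c0 \<Rightarrow> 'a c0" where
  "sgn_c0 f = f /\<^sub>R norm f"

definition uniformity_c0 :: "('a c0 \<times> 'a c0) filter" where
  "uniformity_c0 = (INF e\<in>{0<..}. principal {(f, g). dist f g < e})"

definition open_c0 :: "'a c0 set \<Rightarrow> bool" where
  "open_c0 S = (\<forall>f\<in>S. \<forall>\<^sub>F (f', g) in uniformity. f' = f \<longrightarrow> g \<in> S)"

lemma abs_apply_c0_le: "\<bar>apply_c0 f x\<bar> \<le> norm f"
  unfolding norm_c0.rep_eq by (rule cSUP_upper[OF UNIV_I bdd_above_c0])

lemma norm_c0_le: "(\<And>x. \<bar>apply_c0 f x\<bar> \<le> b) \<Longrightarrow> norm f \<le> b"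
  unfolding norm_c0.rep_eq by (rule cSUP_least) auto

instance
proof
  fix f g :: "'a c0" and a :: real
  show "dist f g = norm (f - g)" by (rule dist_c0_def)
  show "sgn f = f /\<^sub>R norm f" by (rule sgn_c0_def)
  show "uniformity = (INF e\<in>{0<..}. principal {(f :: 'a c0, g). dist f g < e})"
    by (rule uniformity_c0_def)
  show "open S = (\<forall>f\<in>S. \<forall>\<^sub>F (f', g) in uniformity. f' = f \<longrightarrow> g \<in> S)" for S :: "'a c0 set"
    by (rule open_c0_def)
  show "norm f = 0 \<longleftrightarrow> f = 0"
  proof
    assume "norm f = 0"
    then have "apply_c0 f x = 0" for x using abs_apply_c0_le[of f x] by simp
    then show "f = 0" by (intro c0_eqI) (simp add: zero_c0.rep_eq)
  qed (simp add: norm_c0.rep_eq zero_c0.rep_eq)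
  show "norm (f + g) \<le> norm f + norm g"
  proof (rule norm_c0_le)
    fix x
    show "\<bar>apply_c0 (f + g) x\<bar> \<le> norm f + norm g"
      using abs_apply_c0_le[of f x] abs_apply_c0_le[of g x] by (simp add: plus_c0.rep_eq)
  qed
  have le: "norm (c *\<^sub>R k) \<le> \<bar>c\<bar> * norm k" for c and k :: "'a c0"
    by (rule norm_c0_le) (simp add: scaleR_c0.rep_eq abs_mult abs_apply_c0_le mult_left_mono)
  show "norm (a *\<^sub>R f) = \<bar>a\<bar> * norm f"
  proof (cases "a = 0")
    case True
    have "a *\<^sub>R f = 0" using True by (intro c0_eqI) (simp add: scaleR_c0.rep_eq zero_c0.rep_eq)
    with True \<open>norm f = 0 \<longleftrightarrow> f = 0\<close> show ?thesis
      by (simp add: norm_c0.rep_eq zero_c0.rep_eq)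
  next
    case False
    have "inverse a *\<^sub>R (a *\<^sub>R f) = f"
      using False by (intro c0_eqI) (simp add: scaleR_c0.rep_eq)
    with le[of "inverse a" "a *\<^sub>R f"] have "norm f \<le> \<bar>inverse a\<bar> * norm (a *\<^sub>R f)" by simp
    with False have "\<bar>a\<bar> * norm f \<le> norm (a *\<^sub>R f)" by (simp add: field_simps)
    with le[of a f] show ?thesis by simp
  qed
qed

end

instance c0 :: (type) banach
proof
  fix X :: "nat \<Rightarrow> 'a c0"
  assume "Cauchy X"
  have "Cauchy (\<lambda>n. apply_c0 (X n) x)" for x
  proof (rule metric_CauchyI)
    fix e :: real assume "e > 0"
    then obtain M where M: "\<And>m n. m \<ge> M \<Longrightarrow> n \<ge> M \<Longrightarrow> dist (X m) (X n) < e"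
      using metric_CauchyD[OF \<open>Cauchy X\<close>] by blast
    have "dist (apply_c0 (X m) x) (apply_c0 (X n) x) \<le> dist (X m) (X n)" for m n
      using abs_apply_c0_le[of "X m - X n" x] by (simp add: dist_norm minus_c0.rep_eq)
    with M show "\<exists>M. \<forall>m\<ge>M. \<forall>n\<ge>M. dist (apply_c0 (X m) x) (apply_c0 (X n) x) < e"
      using le_less_trans by blast
  qed
  then have "\<forall>x. \<exists>l. (\<lambda>n. apply_c0 (X n) x) \<longlonglongrightarrow> l"
    using Cauchy_convergent unfolding convergent_def by blast
  then obtain f where f: "\<And>x. (\<lambda>n. apply_c0 (X n) x) \<longlonglongrightarrow> f x"
    using choice[of "\<lambda>x l. (\<lambda>n. apply_c0 (X n) x) \<longlonglongrightarrow> l"] by blast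
  have close: "\<exists>M. \<forall>n\<ge>M. \<forall>x. \<bar>apply_c0 (X n) x - f x\<bar> \<le> e" if "e > 0" for e
  proof -
    obtain M where M: "\<And>m n. m \<ge> M \<Longrightarrow> n \<ge> M \<Longrightarrow> dist (X m) (X n) < e"
      using metric_CauchyD[OF \<open>Cauchy X\<close> \<open>e > 0\<close>] by blast
    have "\<bar>apply_c0 (X n) x - f x\<bar> \<le> e" if "n \<ge> M" for n x
    proof (rule LIMSEQ_le_const2)
      show "(\<lambda>m. \<bar>apply_c0 (X n) x - apply_c0 (X m) x\<bar>) \<longlonglongrightarrow> \<bar>apply_c0 (X n) x - f x\<bar>"
        by (intro tendsto_intros f)
      have "\<bar>apply_c0 (X n) x - apply_c0 (X m) x\<bar> \<le> e" if "m \<ge> M" for m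
        using abs_apply_c0_le[of "X n - X m" x] M[OF \<open>n \<ge> M\<close> that]
        by (simp add: dist_norm minus_c0.rep_eq)
      then show "\<exists>N. \<forall>m\<ge>N. \<bar>apply_c0 (X n) x - apply_c0 (X m) x\<bar> \<le> e" by blast
    qed
    then show ?thesis by blast
  qed
  have "finite {x. \<bar>f x\<bar> \<ge> e}" if "e > 0" for e
  proof -
    obtain M where "\<And>x. \<bar>apply_c0 (X M) x - f x\<bar> \<le> e/2"
      using close[of "e/2"] \<open>e > 0\<close> by auto
    then have M: "\<bar>apply_c0 (X M) x - f x\<bar> \<le> e/2" for x .
    have "{x. \<bar>f x\<bar> \<ge> e} \<subseteq> {x. \<bar>apply_c0 (X M) x\<bar> \<ge> e/2}"
    proof (intro Collect_mono impI)
      fix x assume "e \<le> \<bar>f x\<bar>"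
      with M[of x] show "e/2 \<le> \<bar>apply_c0 (X M) x\<bar>" by linarith
    qed
    moreover have "finite {x. \<bar>apply_c0 (X M) x\<bar> \<ge> e/2}"
      by (rule finite_c0) (use \<open>e > 0\<close> in simp)
    ultimately show ?thesis by (rule finite_subset)
  qed
  then obtain F where F: "apply_c0 F = f"
    using Abs_c0_inverse[of f] by auto
  have "X \<longlonglongrightarrow> F"
  proof (rule metric_LIMSEQ_I)
    fix e :: real assume "e > 0"
    then obtain M where "\<forall>n\<ge>M. \<forall>x. \<bar>apply_c0 (X n) x - f x\<bar> \<le> e/2"
      using close[of "e/2"] by auto
    then have "dist (X n) F \<le> e/2" if "n \<ge> M" for n
      unfolding dist_norm by (intro norm_c0_le) (use that in \<open>simp add: minus_c0.rep_eq F\<close>)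
    with \<open>e > 0\<close> show "\<exists>M. \<forall>n\<ge>M. dist (X n) F < e"
      by (intro exI[of _ M]) force
  qed
  then show "convergent X" by (rule convergentI)
qed

section \<open>Continuous functions on a compact space\<close>

text \<open>
  By the next lemma, if \<^typ>\<open>'k\<close> is compact then \<open>'k \<Rightarrow>\<^sub>C 'x\<close> consists of all continuous
  functions, so it is the Banach space of continuous functions with the supremum norm.
\<close>

lemma continuous_imp_bcontfun:
  assumes "compact (UNIV :: 'k::topological_space set)"
    and "continuous_on UNIV (f :: 'k \<Rightarrow> 'x::metric_space)"
  shows "f \<in> bcontfun"
  using compact_imp_bounded[OF compact_continuous_image[OF assms(2,1)]] assms(2)
  unfolding bcontfun_def by simp

section \<open>Complemented copies\<close>

definition complemented_subspace :: "'y::real_normed_vector set \<Rightarrow> bool" where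
  "complemented_subspace S \<longleftrightarrow> subspace S \<and> closed S \<and>
     (\<exists>P. bounded_linear P \<and> P \<circ> P = P \<and> range P = S)"

definition contains_complemented_copy ::
    "'y::real_normed_vector itself \<Rightarrow> 'z::real_normed_vector itself \<Rightarrow> bool" where
  "contains_complemented_copy y z \<longleftrightarrow>
     (\<exists>(S :: 'y set) (T :: 'z \<Rightarrow> 'y) T'.
        complemented_subspace S \<and> linear T \<and> homeomorphism UNIV S T T')"

end

theory Submission
  imports Defs
begin

text \<open>
  A space \<open>Y\<close> contains a complemented copy of \<open>Z\<close> iff the identity of \<open>Z\<close> factors as \<open>Q T\<close> through
  \<open>Y\<close> with bounded operators \<open>T\<close> and \<open>Q\<close>. A factorisation through \<open>X\<close> gives one through \<open>C(K,X)\<close>,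
  because the constant functions and the evaluation at a point factor the identity of \<open>X\<close>.

  For the converse let \<open>Q T\<close> be the identity of \<open>c\<^sub>0(\<tau>)\<close>, factored through \<open>C(K,X)\<close>, and let
  \<open>f\<^sub>i = T e\<^sub>i\<close>. By compactness \<open>K\<close> is covered by finitely many basic open sets on which \<open>f\<^sub>i\<close>
  oscillates by at most \<open>\<epsilon>\<close>. If the weight is infinite, there are only \<open>w(K)\<close> finite families of
  basic sets, and otherwise finitely many; since \<open>\<tau>\<close> is not a union of fewer than \<open>cf(\<tau>)\<close> sets of
  smaller cardinality, one cover serves \<open>\<tau>\<close> many indices \<open>i\<close> (\<open>large_fibre\<close>). A partition of unity
  \<open>(p\<^sub>t)\<close>, with \<open>t\<close> in a finite set \<open>N\<close> of points, that is subordinate to this cover satisfies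
  \<open>\<parallel>f\<^sub>i - \<Sum>\<^sub>t p\<^sub>t f\<^sub>i(t)\<parallel> \<le> \<epsilon>\<close> for all these \<open>i\<close>. As \<open>(Q f\<^sub>i)(i) = 1\<close>, for small \<open>\<epsilon>\<close> the sum of the numbers
  \<open>Q(p\<^sub>t f\<^sub>i(t))(i)\<close> over \<open>t \<in> N\<close> is at least \<open>1/2\<close>, so one of them is at least \<open>\<delta> = 1/(2|N|)\<close>
  in modulus, and the same \<open>t\<close> occurs for \<open>\<tau>\<close> many \<open>i\<close>.

  For this \<open>t\<close>, the operators \<open>V z = (T z)(t)\<close> into \<open>X\<close> and \<open>W x = Q(p\<^sub>t x)\<close> out of \<open>X\<close> have a
  composition \<open>A = W V\<close> on \<open>c\<^sub>0(\<tau>)\<close> whose diagonal entries are at least \<open>\<delta>\<close> in modulus at \<open>\<tau>\<close> many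
  indices. The rows and the columns of the matrix of \<open>A\<close> are null families, so one can pass to a set
  \<open>M\<close> of \<open>\<tau>\<close> of these indices such that the off-diagonal part of every row over \<open>M\<close> has absolute sum
  at most \<open>\<delta>/2\<close> (\<open>almost_diagonal_submatrix\<close>). Compressed to \<open>M\<close> and divided by its diagonal, \<open>A\<close> is
  at distance at most \<open>1/2\<close> from the identity, hence invertible. So the identity of \<open>c\<^sub>0(\<tau>)\<close> factors
  through \<open>X\<close>.
\<close>

section \<open>Complemented copies as factorisations of the identity\<close>

lemma continuous_linear_imp_bounded_linear:
  fixes f :: "'a::real_normed_vector \<Rightarrow> 'b::real_normed_vector"
  assumes "linear f" and "continuous_on UNIV f"
  shows "bounded_linear f"
proof -
  interpret linear f by fact
  have "isCont f 0"
    using assms(2) by (simp add: continuous_on_eq_continuous_at)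
  then obtain d where "d > 0" and d: "\<And>x. dist x 0 < d \<Longrightarrow> dist (f x) (f 0) < 1"
    unfolding continuous_at_eps_delta by (metis zero_less_one)
  have "norm (f x) \<le> norm x * (2 / d)" for x
  proof (cases "x = 0")
    case False
    have "norm (f ((d / (2 * norm x)) *\<^sub>R x)) < 1"
      using d[of "(d / (2 * norm x)) *\<^sub>R x"] False \<open>d > 0\<close> by (simp add: zero)
    then show ?thesis
      using False \<open>d > 0\<close> by (simp add: scale field_simps)
  qed (simp add: zero)
  then show ?thesis
    by (intro bounded_linear_intro[of _ "2 / d"]) (auto simp: add scale)
qed

text \<open>
  From a projection \<open>P\<close> and an isomorphism \<open>T\<close> onto its range with inverse \<open>T'\<close> one gets the
  factorisation \<open>(T' P) T\<close> of the identity; from \<open>Q T = id\<close> one gets the projection \<open>T Q\<close>, whose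
  range \<open>{y. T (Q y) = y}\<close> is closed.
\<close>

lemma contains_complemented_copy_iff:
  "contains_complemented_copy TYPE('y::real_normed_vector) TYPE('z::real_normed_vector) \<longleftrightarrow>
   (\<exists>(T :: 'z \<Rightarrow> 'y) Q. bounded_linear T \<and> bounded_linear Q \<and> (\<forall>z. Q (T z) = z))"
proof
  assume "contains_complemented_copy TYPE('y) TYPE('z)"
  then obtain S :: "'y set" and T :: "'z \<Rightarrow> 'y" and T' P
    where "subspace S" "linear T" and hom: "homeomorphism UNIV S T T'"
      and P: "bounded_linear P" "P \<circ> P = P" "range P = S"
    unfolding contains_complemented_copy_def complemented_subspace_def by blast
  interpret T: linear T by fact
  interpret P: bounded_linear P by fact
  have T': "T' (T z) = z" for z
    using hom by (simp add: homeomorphism_def)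
  have TT': "T (T' (P y)) = P y" for y
    using hom P(3) unfolding homeomorphism_def by blast
  have PT: "P (T z) = T z" for z
  proof -
    obtain y where "T z = P y"
      using hom P(3) unfolding homeomorphism_def by blast
    with P(2) show ?thesis by (metis comp_apply)
  qed
  have "linear (\<lambda>y. T' (P y))"
  proof (rule linearI)
    show "T' (P (x + y)) = T' (P x) + T' (P y)" for x y
      using T'[of "T' (P x) + T' (P y)"] by (simp add: T.add TT' P.add)
    show "T' (P (c *\<^sub>R x)) = c *\<^sub>R T' (P x)" for c x
      using T'[of "c *\<^sub>R T' (P x)"] by (simp add: T.scale TT' P.scaleR)
  qed
  moreover have "continuous_on UNIV (\<lambda>y. T' (P y))"
    using hom P(3) linear_continuous_on[OF P(1), of UNIV] unfolding homeomorphism_def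
    by (auto intro: continuous_on_compose2[of S T' UNIV P])
  ultimately have "bounded_linear (\<lambda>y. T' (P y))"
    by (rule continuous_linear_imp_bounded_linear)
  moreover have "bounded_linear T"
    using \<open>linear T\<close> hom unfolding homeomorphism_def
    by (intro continuous_linear_imp_bounded_linear) auto
  ultimately show "\<exists>(T :: 'z \<Rightarrow> 'y) Q. bounded_linear T \<and> bounded_linear Q \<and> (\<forall>z. Q (T z) = z)"
    by (intro exI[of _ T] exI[of _ "\<lambda>y. T' (P y)"]) (simp add: PT T')
next
  assume "\<exists>(T :: 'z \<Rightarrow> 'y) Q. bounded_linear T \<and> bounded_linear Q \<and> (\<forall>z. Q (T z) = z)"
  then obtain T :: "'z \<Rightarrow> 'y" and Q
    where T: "bounded_linear T" and Q: "bounded_linear Q" and QT: "\<And>z. Q (T z) = z" by blast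
  have range: "range T = {y. T (Q y) = y}"
  proof (intro equalityI subsetI)
    show "y \<in> range T" if "y \<in> {y. T (Q y) = y}" for y
      by (rule range_eqI[of _ T "Q y"]) (use that in simp)
  qed (auto simp: QT)
  have TQ: "bounded_linear (\<lambda>y. T (Q y))"
    by (rule bounded_linear_compose[OF T Q])
  have "closed (range T)"
    unfolding range
    by (intro closed_Collect_eq linear_continuous_on TQ continuous_on_id)
  moreover have "subspace (range T)"
    by (intro linear_subspace_image bounded_linear.linear[OF T] subspace_UNIV)
  moreover have "range (\<lambda>y. T (Q y)) = range T"
  proof (intro equalityI image_subsetI rangeI)
    show "T z \<in> range (\<lambda>y. T (Q y))" for z
      by (rule range_eqI[of _ _ "T z"]) (simp add: QT)
  qed
  ultimately have "complemented_subspace (range T)"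
    unfolding complemented_subspace_def using TQ QT
    by (intro conjI exI[of _ "\<lambda>y. T (Q y)"]) auto
  moreover have "homeomorphism UNIV (range T) T Q"
    unfolding homeomorphism_def
    using QT by (auto simp: image_image intro: linear_continuous_on T Q)
  ultimately show "contains_complemented_copy TYPE('y) TYPE('z)"
    unfolding contains_complemented_copy_def using bounded_linear.linear[OF T] by blast
qed

section \<open>Operators on null functions\<close>

lift_definition unit_c0 :: "'g \<Rightarrow> 'g c0" is "\<lambda>j i. if i = j then 1 else 0"
proof -
  fix j :: 'g and e :: real
  assume "e > 0"
  then have "{i. e \<le> \<bar>if i = j then 1 else 0 :: real\<bar>} \<subseteq> {j}"
    by (auto split: if_splits)
  then show "finite {i. e \<le> \<bar>if i = j then 1 else 0 :: real\<bar>}"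
    by (rule finite_subset) simp
qed

lemma apply_c0_sum: "apply_c0 (\<Sum>j\<in>F. h j) i = (\<Sum>j\<in>F. apply_c0 (h j) i)"
  by (induction F rule: infinite_finite_induct) (simp_all add: zero_c0.rep_eq plus_c0.rep_eq)

lemma apply_finite_combination:
  assumes "finite F"
  shows "apply_c0 (\<Sum>j\<in>F. c j *\<^sub>R unit_c0 j) i = (if i \<in> F then c i else 0)"
proof -
  have "apply_c0 (\<Sum>j\<in>F. c j *\<^sub>R unit_c0 j) i = (\<Sum>j\<in>F. if i = j then c j else 0)"
    unfolding apply_c0_sum by (intro sum.cong) (auto simp: scaleR_c0.rep_eq unit_c0.rep_eq)
  then show ?thesis using assms by simp
qed

text \<open>
  These operators embed \<open>c\<^sub>0\<close> onto the coordinates in a subset, restrict to such coordinates, and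
  divide by the diagonal of a matrix. Injectivity keeps preimages of finite sets finite, so that null
  functions stay null.
\<close>

lemma weighted_composition_c0:
  fixes w :: "'a \<Rightarrow> real" and \<sigma> :: "'a \<Rightarrow> 'b"
  assumes w: "\<And>i. \<bar>w i\<bar> \<le> C" and inj: "inj_on \<sigma> {i. w i \<noteq> 0}"
  obtains R :: "'b c0 \<Rightarrow> 'a c0"
  where "bounded_linear R" and "\<And>f i. apply_c0 (R f) i = w i * apply_c0 f (\<sigma> i)"
proof -
  have "0 \<le> C" using w[of undefined] by linarith
  have fin: "finite {i. e \<le> \<bar>w i * apply_c0 f (\<sigma> i)\<bar>}" if "e > 0" for e and f :: "'b c0"
  proof (rule finite_imageD)
    let ?A = "{i. e \<le> \<bar>w i * apply_c0 f (\<sigma> i)\<bar>}"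
    have "e / (C + 1) \<le> \<bar>apply_c0 f (\<sigma> i)\<bar>" if "i \<in> ?A" for i
    proof -
      have "e \<le> \<bar>w i\<bar> * \<bar>apply_c0 f (\<sigma> i)\<bar>" using that by (simp add: abs_mult)
      also have "\<dots> \<le> (C + 1) * \<bar>apply_c0 f (\<sigma> i)\<bar>"
        using w[of i] by (intro mult_right_mono) auto
      finally show ?thesis using \<open>0 \<le> C\<close> by (simp add: field_simps)
    qed
    then have "\<sigma> ` ?A \<subseteq> {k. e / (C + 1) \<le> \<bar>apply_c0 f k\<bar>}" by blast
    then show "finite (\<sigma> ` ?A)"
      by (rule finite_subset) (use \<open>0 \<le> C\<close> that in \<open>auto intro!: finite_c0\<close>)
    show "inj_on \<sigma> ?A"
      by (rule inj_on_subset[OF inj]) (use that in auto)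
  qed
  define R where "R f = Abs_c0 (\<lambda>i. w i * apply_c0 f (\<sigma> i))" for f
  have R: "apply_c0 (R f) i = w i * apply_c0 f (\<sigma> i)" for f i
    unfolding R_def by (subst Abs_c0_inverse) (use fin in auto)
  have "bounded_linear R"
  proof (rule bounded_linear_intro[of _ C])
    show "norm (R f) \<le> norm f * C" for f
    proof (rule norm_c0_le)
      fix i
      show "\<bar>apply_c0 (R f) i\<bar> \<le> norm f * C"
        using mult_mono[OF abs_apply_c0_le[of f "\<sigma> i"] w[of i]]
        by (simp add: R abs_mult mult.commute)
    qed
  qed (auto intro!: c0_eqI simp: R plus_c0.rep_eq scaleR_c0.rep_eq algebra_simps)
  with R show thesis using that by blast
qed

text \<open>
  A row of the matrix is a bounded functional on \<open>c\<^sub>0\<close>, so its absolute sum is detected by a vector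
  of signs, which has norm at most \<open>1\<close>.
\<close>

lemma row_sum_le:
  assumes "bounded_linear (A :: 'b c0 \<Rightarrow> 'a c0)" and "finite F"
  shows "(\<Sum>j\<in>F. \<bar>apply_c0 (A (unit_c0 j)) i\<bar>) \<le> onorm A"
proof -
  interpret A: bounded_linear A by fact
  let ?u = "\<Sum>j\<in>F. sgn (apply_c0 (A (unit_c0 j)) i) *\<^sub>R unit_c0 j"
  have "(\<Sum>j\<in>F. \<bar>apply_c0 (A (unit_c0 j)) i\<bar>) = apply_c0 (A ?u) i"
    by (simp add: A.sum A.scaleR apply_c0_sum scaleR_c0.rep_eq abs_sgn mult.commute)
  also have "\<dots> \<le> norm (A ?u)"
    using abs_apply_c0_le[of "A ?u" i] by linarith
  also have "\<dots> \<le> onorm A * norm ?u"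
    by (rule onorm[OF assms(1)])
  also have "\<dots> \<le> onorm A * 1"
  proof (intro mult_left_mono onorm_pos_le[OF assms(1)] norm_c0_le)
    show "\<bar>apply_c0 ?u k\<bar> \<le> 1" for k
      using assms(2) by (simp add: apply_finite_combination abs_sgn_eq)
  qed
  finally show ?thesis by simp
qed

text \<open>
  By the previous bound, at most \<open>\<parallel>A\<parallel> / e\<close> entries of a row can have modulus at least \<open>e\<close>.
\<close>

lemma row_null:
  assumes "bounded_linear (A :: 'b c0 \<Rightarrow> 'a c0)" and "e > 0"
  shows "finite {j. e \<le> \<bar>apply_c0 (A (unit_c0 j)) i\<bar>}"
proof (rule ccontr)
  let ?S = "{j. e \<le> \<bar>apply_c0 (A (unit_c0 j)) i\<bar>}"
  obtain n :: nat where n: "onorm A < real n * e"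
    using \<open>e > 0\<close> reals_Archimedean3 by blast
  assume "infinite ?S"
  then obtain F where F: "finite F" "card F = n" "F \<subseteq> ?S"
    using infinite_arbitrarily_large by blast
  have "real n * e = (\<Sum>j\<in>F. e)" using F(2) by simp
  also have "\<dots> \<le> (\<Sum>j\<in>F. \<bar>apply_c0 (A (unit_c0 j)) i\<bar>)"
    by (intro sum_mono) (use F(3) in auto)
  also have "\<dots> \<le> onorm A" by (rule row_sum_le[OF assms(1) F(1)])
  finally show False using n by linarith
qed

text \<open>
  For finitely supported \<open>f\<close> this is the triangle inequality; the general case follows by truncating
  \<open>f\<close> at a small height \<open>d\<close>, which changes the value by at most \<open>\<parallel>A\<parallel> d\<close>.
\<close>

lemma coordinate_bound_from_row:
  assumes A: "bounded_linear (A :: 'b c0 \<Rightarrow> 'a c0)"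
    and supp: "\<And>j. j \<notin> M \<Longrightarrow> apply_c0 f j = 0"
    and row: "\<And>F. finite F \<Longrightarrow> F \<subseteq> M \<Longrightarrow> (\<Sum>j\<in>F. \<bar>apply_c0 (A (unit_c0 j)) i\<bar>) \<le> \<eta>"
  shows "\<bar>apply_c0 (A f) i\<bar> \<le> \<eta> * norm f"
proof (rule field_le_epsilon)
  fix e :: real assume "e > 0"
  interpret A: bounded_linear A by fact
  define d where "d = e / (onorm A + 1)"
  have "onorm A \<ge> 0" by (rule onorm_pos_le[OF A])
  with \<open>e > 0\<close> have "d > 0" by (simp add: d_def)
  define F where "F = {j. d \<le> \<bar>apply_c0 f j\<bar>}"
  have "finite F" unfolding F_def using \<open>d > 0\<close> by (rule finite_c0)
  have "F \<subseteq> M" using supp \<open>d > 0\<close> unfolding F_def by force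
  define g where "g = (\<Sum>j\<in>F. apply_c0 f j *\<^sub>R unit_c0 j)"
  have "norm (f - g) \<le> d"
  proof (rule norm_c0_le)
    show "\<bar>apply_c0 (f - g) j\<bar> \<le> d" for j
      using \<open>finite F\<close> \<open>d > 0\<close>
      by (auto simp: minus_c0.rep_eq g_def apply_finite_combination) (simp add: F_def)
  qed
  have "\<bar>apply_c0 (A g) i\<bar> \<le> (\<Sum>j\<in>F. \<bar>apply_c0 f j * apply_c0 (A (unit_c0 j)) i\<bar>)"
    by (simp add: g_def A.sum A.scaleR apply_c0_sum scaleR_c0.rep_eq sum_abs)
  also have "\<dots> \<le> (\<Sum>j\<in>F. norm f * \<bar>apply_c0 (A (unit_c0 j)) i\<bar>)"
    by (intro sum_mono) (simp add: abs_mult mult_right_mono abs_apply_c0_le)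
  also have "\<dots> \<le> norm f * \<eta>"
    unfolding sum_distrib_left[symmetric]
    by (intro mult_left_mono row \<open>finite F\<close> \<open>F \<subseteq> M\<close>) simp
  finally have g: "\<bar>apply_c0 (A g) i\<bar> \<le> \<eta> * norm f" by (simp add: mult.commute)
  have "\<bar>apply_c0 (A (f - g)) i\<bar> \<le> norm (A (f - g))" by (rule abs_apply_c0_le)
  also have "\<dots> \<le> onorm A * norm (f - g)" by (rule onorm[OF A])
  also have "\<dots> \<le> (onorm A + 1) * d"
    using \<open>norm (f - g) \<le> d\<close> \<open>onorm A \<ge> 0\<close> by (intro mult_mono) auto
  also have "\<dots> = e" using \<open>onorm A \<ge> 0\<close> by (simp add: d_def)
  finally have "\<bar>apply_c0 (A (f - g)) i\<bar> \<le> e" .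
  moreover have "apply_c0 (A f) i = apply_c0 (A g) i + apply_c0 (A (f - g)) i"
    by (simp add: A.diff minus_c0.rep_eq)
  ultimately show "\<bar>apply_c0 (A f) i\<bar> \<le> \<eta> * norm f + e" using g by linarith
qed

text \<open>
  The equation \<open>S f = g\<close> is the fixed point equation of the contraction \<open>f \<mapsto> g - (S f - f)\<close>, so
  by completeness it has exactly one solution, which depends linearly and boundedly on \<open>g\<close>.
\<close>

lemma inverse_of_half_perturbation:
  fixes S :: "'a::banach \<Rightarrow> 'a"
  assumes S: "bounded_linear S" and half: "\<And>f. norm (S f - f) \<le> norm f / 2"
  obtains R where "bounded_linear R" and "\<And>f. R (S f) = f"
proof -
  interpret S: bounded_linear S by fact
  have ex1: "\<exists>!f. f = g - (S f - f)" for g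
  proof -
    have "dist (g - (S f - f)) (g - (S h - h)) \<le> 1 / 2 * dist f h" for f h
      using half[of "h - f"] by (simp add: dist_norm S.diff algebra_simps norm_minus_commute)
    then have "\<exists>!f. (\<lambda>f. g - (S f - f)) f = f"
      by (intro banach_fix_type[of "1/2"]) auto
    then show ?thesis by (simp only: eq_commute)
  qed
  then have "\<forall>g. \<exists>f. f = g - (S f - f)" by blast
  from choice[OF this] obtain R where R: "\<And>g. R g = g - (S (R g) - R g)" by blast
  have SR: "S (R g) = g" for g using R[of g] by (simp add: algebra_simps)
  have inj: "f = h" if "S f = S h" for f h
  proof -
    have "f = S f - (S f - f)" "h = S f - (S h - h)" using that by simp_all
    with ex1[of "S f"] show ?thesis by blast
  qed
  have "bounded_linear R"
  proof (rule bounded_linear_intro[of _ 2])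
    show "R (x + y) = R x + R y" for x y by (rule inj) (simp add: SR S.add)
    show "R (c *\<^sub>R x) = c *\<^sub>R R x" for c x by (rule inj) (simp add: SR S.scaleR)
    show "norm (R x) \<le> norm x * 2" for x
      using half[of "R x"] norm_triangle_ineq2[of "R x" x]
      by (simp add: SR norm_minus_commute)
  qed
  moreover have "R (S f) = f" for f by (rule inj) (simp add: SR)
  ultimately show thesis using that by blast
qed

section \<open>Almost diagonal submatrices\<close>

text \<open>
  View \<open>E i\<close> as the neighbourhood of a vertex \<open>i\<close> in a graph with countable degrees. A maximal
  independent set \<open>M\<close> together with its neighbours is all of \<open>G\<close>, and this union is no larger than \<open>M\<close>
  when \<open>M\<close> is infinite; a finite \<open>M\<close> would make \<open>G\<close> countable.
\<close>

lemma uncountable_independent_subset: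
  fixes E :: "'g \<Rightarrow> 'g set"
  assumes G: "uncountable G" and E: "\<And>i. i \<in> G \<Longrightarrow> countable (E i)"
    and sym: "\<And>i j. i \<in> G \<Longrightarrow> j \<in> E i \<Longrightarrow> i \<in> E j"
  shows "\<exists>M. M \<subseteq> G \<and> |M| =o |G| \<and> (\<forall>i\<in>M. \<forall>j\<in>M. i \<noteq> j \<longrightarrow> j \<notin> E i)"
proof -
  let ?I = "{M. M \<subseteq> G \<and> (\<forall>i\<in>M. \<forall>j\<in>M. i \<noteq> j \<longrightarrow> j \<notin> E i)}"
  have "\<exists>M\<in>?I. \<forall>X\<in>?I. M \<subseteq> X \<longrightarrow> X = M"
  proof (rule subset_Zorn')
    fix C assume C: "subset.chain ?I C"
    then have *: "C \<subseteq> ?I \<and> (\<forall>X\<in>C. \<forall>Y\<in>C. X \<subseteq> Y \<or> Y \<subseteq> X)"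
      unfolding subset_chain_def .
    note sub = conjunct1[OF *] and chain = conjunct2[OF *, THEN bspec, THEN bspec]
    have "j \<notin> E i" if ij: "i \<in> \<Union> C" "j \<in> \<Union> C" "i \<noteq> j" for i j
    proof -
      obtain X Y where XY: "i \<in> X" "X \<in> C" "j \<in> Y" "Y \<in> C"
        using ij(1,2) by blast
      then obtain Z where "i \<in> Z" "j \<in> Z" "Z \<in> C" using chain[OF XY(2,4)] by blast
      moreover have "Z \<in> ?I" using sub \<open>Z \<in> C\<close> by (rule subsetD)
      ultimately show ?thesis using \<open>i \<noteq> j\<close> by simp
    qed
    moreover have "\<Union> C \<subseteq> G"
    proof (rule Union_least)
      show "X \<subseteq> G" if "X \<in> C" for X using subsetD[OF sub that] by simp
    qed
    ultimately show "\<Union> C \<in> ?I" by simp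
  qed
  then obtain M where M: "M \<in> ?I" and max: "\<forall>X\<in>?I. M \<subseteq> X \<longrightarrow> X = M" ..
  have cover: "G \<subseteq> (\<Union>i\<in>M. insert i (E i))"
  proof
    fix g assume "g \<in> G"
    show "g \<in> (\<Union>i\<in>M. insert i (E i))"
    proof (rule ccontr)
      assume no: "g \<notin> (\<Union>i\<in>M. insert i (E i))"
      have "j \<notin> E i" if "i \<in> insert g M" "j \<in> insert g M" "i \<noteq> j" for i j
      proof (cases "i = g")
        case True
        with that have "j \<in> M" by simp
        then show ?thesis using no sym[OF \<open>g \<in> G\<close>] True by blast
      next
        case False
        with that have "i \<in> M" by simp
        then show ?thesis using no M that by blast
      qed
      then have "insert g M \<in> ?I" using M \<open>g \<in> G\<close> by simp
      from bspec[OF max this] have "insert g M = M" by blast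
      then show False using no by blast
    qed
  qed
  have cnt: "countable (insert i (E i))" if "i \<in> M" for i
  proof -
    have "i \<in> G" using M that by auto
    then show ?thesis using E by simp
  qed
  have "infinite M"
  proof
    assume "finite M"
    then have "countable (\<Union>i\<in>M. insert i (E i))"
      using cnt by (rule countable_UN[OF countable_finite])
    with cover G show False using countable_subset by blast
  qed
  have "|insert i (E i)| \<le>o |M|" if "i \<in> M" for i
  proof -
    have "|insert i (E i)| \<le>o |UNIV :: nat set|"
      using cnt[OF that] card_of_ordLeq[of "insert i (E i)" "UNIV :: nat set"]
      unfolding countable_def by simp
    then show ?thesis
      using \<open>infinite M\<close> infinite_iff_card_of_nat ordLeq_transitive by blast
  qed
  then have "|\<Union>i\<in>M. insert i (E i)| \<le>o |M|"
    by (intro card_of_UNION_ordLeq_infinite[OF \<open>infinite M\<close>] ballI)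
      (rule ordLeq_refl[OF card_of_Card_order])
  then have "|G| \<le>o |M|"
    using card_of_mono1[OF cover] ordLeq_transitive by blast
  moreover have "|M| \<le>o |G|" using M by (intro card_of_mono1) auto
  ultimately have "|M| =o |G|" by (simp add: ordIso_iff_ordLeq)
  with M show ?thesis by (intro exI[of _ M]) simp
qed

text \<open>
  The indices are chosen so sparsely that, by nullity of the first rows and columns, every entry
  between an index up to \<open>f n\<close> and one from \<open>f (n + 1)\<close> on is at most \<open>\<eta> / 4 * (1/2) ^ n\<close>. The bound
  is needed in terms of the column index \<open>l\<close> alone: for \<open>l < k\<close> the step \<open>n = l\<close> gives it, for
  \<open>l > k\<close> the step \<open>n = l - 1\<close>, at the cost of a factor \<open>2\<close>.
\<close>

lemma almost_diagonal_sequence: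
  fixes a :: "nat \<Rightarrow> nat \<Rightarrow> real"
  assumes row: "\<And>i e. e > 0 \<Longrightarrow> finite {j. e \<le> \<bar>a i j\<bar>}"
    and col: "\<And>j e. e > 0 \<Longrightarrow> finite {i. e \<le> \<bar>a i j\<bar>}"
    and "\<eta> > 0"
  shows "\<exists>f :: nat \<Rightarrow> nat. strict_mono f \<and>
    (\<forall>k. \<forall>F. finite F \<longrightarrow> k \<notin> F \<longrightarrow> (\<Sum>l\<in>F. \<bar>a (f k) (f l)\<bar>) \<le> \<eta>)"
proof -
  define e :: "nat \<Rightarrow> real" where "e n = \<eta> / 4 * (1/2) ^ n" for n
  have e: "e n > 0" for n using \<open>\<eta> > 0\<close> by (simp add: e_def)
  let ?P = "\<lambda>n x y. x < y \<and> (\<forall>m\<le>x. \<forall>j\<ge>y. \<bar>a m j\<bar> \<le> e n \<and> \<bar>a j m\<bar> \<le> e n)"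
  have "\<exists>y. ?P n x y" for n x
  proof -
    let ?B = "\<Union>m\<in>{..x}. {j. e n \<le> \<bar>a m j\<bar>} \<union> {j. e n \<le> \<bar>a j m\<bar>}"
    have "finite ({..x} \<union> ?B)" using row col e by simp
    then obtain y where "\<forall>j\<in>{..x} \<union> ?B. j < y" using finite_nat_set_iff_bounded by blast
    then have y: "\<And>j. j \<in> {..x} \<union> ?B \<Longrightarrow> j < y" by blast
    have "\<bar>a m j\<bar> \<le> e n \<and> \<bar>a j m\<bar> \<le> e n" if "m \<le> x" "y \<le> j" for m j
    proof -
      have "j \<notin> ?B" using y[of j] that(2) by auto
      with that(1) have "\<not> e n \<le> \<bar>a m j\<bar>" "\<not> e n \<le> \<bar>a j m\<bar>" by blast+
      then show ?thesis by simp
    qed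
    with y[of x] show ?thesis by auto
  qed
  then obtain f where f: "\<And>n. ?P n (f n) (f (Suc n))"
    using dependent_nat_choice[of "\<lambda>_ _. True" ?P] by auto
  have mono: "strict_mono f" using f by (simp add: strict_mono_Suc_iff)
  have entry: "\<bar>a (f k) (f l)\<bar> \<le> \<eta> / 2 * (1/2) ^ l" if "k \<noteq> l" for k l
  proof (cases "k < l")
    case True
    then obtain n where n: "l = Suc n" "k \<le> n" by (cases l) auto
    then have "f k \<le> f n" using mono by (simp add: strict_mono_less_eq)
    then have "\<bar>a (f k) (f l)\<bar> \<le> e n" using f[of n] n by blast
    then show ?thesis by (simp add: n e_def)
  next
    case False
    then have "f (Suc l) \<le> f k" using mono that by (simp add: strict_mono_less_eq)
    then have "\<bar>a (f k) (f l)\<bar> \<le> e l" using f[of l] by blast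
    also have "\<dots> \<le> \<eta> / 2 * (1/2) ^ l" using \<open>\<eta> > 0\<close> by (simp add: e_def)
    finally show ?thesis .
  qed
  have bound: "(\<Sum>l\<in>F. \<bar>a (f k) (f l)\<bar>) \<le> \<eta>" if "finite F" "k \<notin> F" for k F
  proof -
    have "(\<lambda>l. \<eta> / 2 * (1/2) ^ l) sums (\<eta> / 2 * 2)"
      using geometric_sums[of "1/2 :: real"] by (intro sums_mult) simp
    then have sums: "(\<lambda>l. \<eta> / 2 * (1/2) ^ l) sums \<eta>" by simp
    have "(\<Sum>l\<in>F. \<bar>a (f k) (f l)\<bar>) \<le> (\<Sum>l\<in>F. \<eta> / 2 * (1/2) ^ l)"
      using that(2) by (intro sum_mono entry) auto
    also have "\<dots> \<le> (\<Sum>l. \<eta> / 2 * (1/2) ^ l)"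
      using \<open>\<eta> > 0\<close> by (intro sum_le_suminf sums_summable[OF sums] that(1)) simp
    also have "\<dots> = \<eta>" by (rule sums_unique[OF sums, symmetric])
    finally show ?thesis .
  qed
  show ?thesis
    by (rule exI[of _ f], intro conjI allI impI mono bound)
qed

text \<open>
  A countable set of indices is thinned out to a sparse sequence. For uncountable \<open>G\<close> no estimates are
  involved: a null family has only countably many non-zero members, so an independent set of the graph
  of non-zero entries is a set on which the matrix is exactly diagonal.
\<close>

lemma almost_diagonal_submatrix:
  fixes a :: "'g \<Rightarrow> 'g \<Rightarrow> real"
  assumes G: "infinite G" and "\<eta> > 0"
    and row: "\<And>i e. e > 0 \<Longrightarrow> finite {j. e \<le> \<bar>a i j\<bar>}"
    and col: "\<And>j e. e > 0 \<Longrightarrow> finite {i. e \<le> \<bar>a i j\<bar>}"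
  shows "\<exists>M. M \<subseteq> G \<and> |M| =o |G| \<and>
    (\<forall>i\<in>M. \<forall>F. finite F \<longrightarrow> F \<subseteq> M - {i} \<longrightarrow> (\<Sum>j\<in>F. \<bar>a i j\<bar>) \<le> \<eta>)"
proof (cases "countable G")
  case True
  define b where "b = from_nat_into G"
  have b: "bij_betw b UNIV G"
    unfolding b_def by (rule bij_betw_from_nat_into[OF True G])
  then have inj: "inj b" by (simp add: bij_betw_def)
  have "finite {l. e \<le> \<bar>a (b k) (b l)\<bar>}" if "e > 0" for k e
    using finite_vimageI[OF row[OF that, of "b k"] inj] by (simp add: vimage_def)
  moreover have "finite {k. e \<le> \<bar>a (b k) (b l)\<bar>}" if "e > 0" for l e
    using finite_vimageI[OF col[OF that, of "b l"] inj] by (simp add: vimage_def)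
  ultimately obtain f :: "nat \<Rightarrow> nat" where f: "strict_mono f"
    and sum: "\<And>k F. finite F \<Longrightarrow> k \<notin> F \<Longrightarrow> (\<Sum>l\<in>F. \<bar>a (b (f k)) (b (f l))\<bar>) \<le> \<eta>"
    using almost_diagonal_sequence[of "\<lambda>k l. a (b k) (b l)" \<eta>] \<open>\<eta> > 0\<close> by auto
  define M where "M = range (b \<circ> f)"
  have bf: "inj (b \<circ> f)"
    using inj strict_mono_imp_inj_on[OF f] by (rule inj_compose)
  have "bij_betw (b \<circ> f \<circ> inv_into UNIV b) G M"
    unfolding M_def
    using bij_betw_trans[OF bij_betw_inv_into[OF b] inj_on_imp_bij_betw[OF bf]] .
  then have "|M| =o |G|"
    using card_of_ordIsoI ordIso_symmetric by blast
  moreover have "M \<subseteq> G" using b by (auto simp: M_def bij_betw_def)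
  moreover have "(\<Sum>j\<in>F. \<bar>a i j\<bar>) \<le> \<eta>"
    if "i \<in> M" and F: "finite F" "F \<subseteq> M - {i}" for i F
  proof -
    obtain k where k: "i = b (f k)" using \<open>i \<in> M\<close> by (auto simp: M_def)
    obtain L where L: "F = (b \<circ> f) ` L" "finite L"
      using F finite_subset_image[of F "b \<circ> f" UNIV] unfolding M_def by blast
    have "(\<Sum>j\<in>F. \<bar>a i j\<bar>) = (\<Sum>l\<in>L. \<bar>a (b (f k)) (b (f l))\<bar>)"
      unfolding L(1) k by (subst sum.reindex[OF inj_on_subset[OF bf]]) auto
    also have "\<dots> \<le> \<eta>"
      using L F(2) k by (intro sum) auto
    finally show ?thesis .
  qed
  ultimately show ?thesis by (intro exI[of _ M]) simp
next
  case False
  define E where "E i = {j. a i j \<noteq> 0 \<or> a j i \<noteq> 0}" for i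
  have null: "countable {j. c j \<noteq> 0}"
    if fin: "\<And>e. e > 0 \<Longrightarrow> finite {j. e \<le> \<bar>c j\<bar>}" for c :: "'g \<Rightarrow> real"
  proof -
    have "j \<in> (\<Union>n. {j. inverse (real (Suc n)) \<le> \<bar>c j\<bar>})" if nz: "c j \<noteq> 0" for j
    proof -
      obtain n where "inverse (real (Suc n)) < \<bar>c j\<bar>"
        using reals_Archimedean[of "\<bar>c j\<bar>"] nz by auto
      then show ?thesis by (intro UN_I[of n]) auto
    qed
    then have "{j. c j \<noteq> 0} \<subseteq> (\<Union>n. {j. inverse (real (Suc n)) \<le> \<bar>c j\<bar>})" by blast
    moreover have "countable (\<Union>n. {j. inverse (real (Suc n)) \<le> \<bar>c j\<bar>})"
      by (rule countable_UN[OF countableI_type]) (auto intro!: countable_finite fin)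
    ultimately show ?thesis by (rule countable_subset)
  qed
  have cnt: "countable (E i)" for i
  proof -
    have "E i = {j. a i j \<noteq> 0} \<union> {j. a j i \<noteq> 0}" by (auto simp: E_def)
    then show ?thesis using null[of "a i"] null[of "\<lambda>j. a j i"] row col by simp
  qed
  have sym: "i \<in> E j" if "j \<in> E i" for i j using that by (auto simp: E_def)
  obtain M where M: "M \<subseteq> G" "|M| =o |G|" "\<And>i j. i \<in> M \<Longrightarrow> j \<in> M \<Longrightarrow> i \<noteq> j \<Longrightarrow> j \<notin> E i"
    using uncountable_independent_subset[of G E, OF False cnt sym] by blast
  have "(\<Sum>j\<in>F. \<bar>a i j\<bar>) \<le> \<eta>" if "i \<in> M" "F \<subseteq> M - {i}" for i F
  proof -
    have "(\<Sum>j\<in>F. \<bar>a i j\<bar>) = 0"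
      using M(3)[OF that(1)] that(2) by (intro sum.neutral) (auto simp: E_def)
    with \<open>\<eta> > 0\<close> show ?thesis by simp
  qed
  with M(1,2) show ?thesis by (intro exI[of _ M]) simp
qed

section \<open>Complemented copies from a large diagonal\<close>

text \<open>
  Let \<open>A = W V\<close>, let \<open>M \<subseteq> G\<close> carry an almost diagonal submatrix, and let \<open>b\<close> enumerate \<open>M\<close> by the whole
  index type. With \<open>\<iota>\<close> the embedding onto the coordinates in \<open>M\<close> and \<open>\<rho>\<close> the restriction to these
  coordinates followed by division by the diagonal, \<open>\<rho> A \<iota>\<close> differs from the identity only by the
  off-diagonal terms, which are at most \<open>\<delta>/2\<close> before the division by at least \<open>\<delta>\<close>. Inverting it turns
  \<open>V \<iota>\<close> and \<open>\<rho> W\<close> into a factorisation of the identity through \<open>X\<close>.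
\<close>

lemma complemented_copy_from_large_diagonal:
  fixes V :: "'g c0 \<Rightarrow> 'x::real_normed_vector" and W :: "'x \<Rightarrow> 'g c0"
  assumes V: "bounded_linear V" and W: "bounded_linear W"
    and "infinite (UNIV :: 'g set)" and G: "|G| =o |UNIV :: 'g set|"
    and "\<delta> > 0" and diag: "\<And>g. g \<in> G \<Longrightarrow> \<delta> \<le> \<bar>apply_c0 (W (V (unit_c0 g))) g\<bar>"
  shows "contains_complemented_copy TYPE('x) TYPE('g c0)"
proof -
  define A where "A f = W (V f)" for f
  have A: "bounded_linear A"
    unfolding A_def by (rule bounded_linear_compose[OF W V])
  interpret A: bounded_linear A by fact
  define a where "a i j = apply_c0 (A (unit_c0 j)) i" for i j
  have "infinite G"
    using G assms(3) card_of_ordIso_finite by blast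
  moreover have "\<delta> / 2 > 0" using \<open>\<delta> > 0\<close> by simp
  moreover have "finite {j. e \<le> \<bar>a i j\<bar>}" "finite {j. e \<le> \<bar>a j i\<bar>}" if "e > 0" for e i
    unfolding a_def using row_null[OF A that] finite_c0[OF that] .
  ultimately have "\<exists>M. M \<subseteq> G \<and> |M| =o |G| \<and>
      (\<forall>i\<in>M. \<forall>F. finite F \<longrightarrow> F \<subseteq> M - {i} \<longrightarrow> (\<Sum>j\<in>F. \<bar>a i j\<bar>) \<le> \<delta> / 2)"
    by (rule almost_diagonal_submatrix)
  then obtain M where M: "M \<subseteq> G" "|M| =o |G|"
    and row: "\<forall>i\<in>M. \<forall>F. finite F \<longrightarrow> F \<subseteq> M - {i} \<longrightarrow> (\<Sum>j\<in>F. \<bar>a i j\<bar>) \<le> \<delta> / 2"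
    by (elim exE conjE)
  have "|UNIV :: 'g set| =o |M|"
    using M(2) G ordIso_transitive ordIso_symmetric by blast
  then obtain b :: "'g \<Rightarrow> 'g" where b: "bij_betw b UNIV M"
    using card_of_ordIso[of "UNIV :: 'g set" M] by blast
  then have "inj b" and bM: "b k \<in> M" for k by (auto simp: bij_betw_def)
  have aii: "\<delta> \<le> \<bar>a i i\<bar>" if "i \<in> M" for i
    using diag M(1) that by (auto simp: a_def A_def)
  have "\<bar>if i \<in> M then 1 else 0 :: real\<bar> \<le> 1" for i by simp
  moreover have "inj_on (inv_into UNIV b) {i. (if i \<in> M then 1 else 0 :: real) \<noteq> 0}"
    using bij_betw_inv_into[OF b] by (simp add: bij_betw_def)
  ultimately obtain \<iota> :: "'g c0 \<Rightarrow> 'g c0" where \<iota>: "bounded_linear \<iota>"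
    and apply_\<iota>: "\<And>f i. apply_c0 (\<iota> f) i = (if i \<in> M then 1 else 0) * apply_c0 f (inv_into UNIV b i)"
    by (rule weighted_composition_c0) (rule that)
  have "\<bar>1 / a (b k) (b k)\<bar> \<le> 1 / \<delta>" for k
    using aii[OF bM, of k] \<open>\<delta> > 0\<close> by (simp add: abs_divide frac_le)
  moreover have "inj_on b {k. 1 / a (b k) (b k) \<noteq> 0}"
    using \<open>inj b\<close> by (rule inj_on_subset) simp
  ultimately obtain \<rho> :: "'g c0 \<Rightarrow> 'g c0" where \<rho>: "bounded_linear \<rho>"
    and apply_\<rho>: "\<And>f k. apply_c0 (\<rho> f) k = 1 / a (b k) (b k) * apply_c0 f (b k)"
    by (rule weighted_composition_c0) (rule that)
  have \<iota>b: "apply_c0 (\<iota> f) (b k) = apply_c0 f k" for f k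
    using bM[of k] \<open>inj b\<close> by (simp add: apply_\<iota>)
  have "norm (\<rho> (A (\<iota> f)) - f) \<le> norm f / 2" for f
  proof (rule norm_c0_le)
    fix k
    \<comment> \<open>Removing the \<open>b k\<close>-th coordinate from \<open>\<iota> f\<close> isolates the off-diagonal part of the row.\<close>
    define g where "g = \<iota> f - apply_c0 f k *\<^sub>R unit_c0 (b k)"
    have g: "apply_c0 g j = (if j = b k then 0 else apply_c0 (\<iota> f) j)" for j
      by (simp add: g_def minus_c0.rep_eq scaleR_c0.rep_eq unit_c0.rep_eq \<iota>b)
    have "norm g \<le> norm f"
      by (rule norm_c0_le) (auto simp: g apply_\<iota> abs_apply_c0_le)
    have "\<bar>apply_c0 (A g) (b k)\<bar> \<le> \<delta> / 2 * norm g"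
    proof (rule coordinate_bound_from_row[OF A])
      show "apply_c0 g j = 0" if "j \<notin> M - {b k}" for j
        using that by (auto simp: g apply_\<iota>)
      show "(\<Sum>j\<in>F. \<bar>apply_c0 (A (unit_c0 j)) (b k)\<bar>) \<le> \<delta> / 2"
        if "finite F" "F \<subseteq> M - {b k}" for F
        using row bM that by (simp add: a_def)
    qed
    also have "\<dots> \<le> \<delta> / 2 * norm f"
      using \<open>norm g \<le> norm f\<close> \<open>\<delta> > 0\<close> by (intro mult_left_mono) auto
    finally have Ag: "\<bar>apply_c0 (A g) (b k)\<bar> \<le> \<delta> / 2 * norm f" .
    have "a (b k) (b k) \<noteq> 0" using aii[OF bM, of k] \<open>\<delta> > 0\<close> by auto
    then have "apply_c0 (\<rho> (A (\<iota> f)) - f) k = apply_c0 (A g) (b k) / a (b k) (b k)"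
      by (simp add: g_def A.diff A.scaleR minus_c0.rep_eq scaleR_c0.rep_eq apply_\<rho> field_simps
          flip: a_def)
    also have "\<bar>\<dots>\<bar> \<le> (\<delta> / 2 * norm f) / \<delta>"
      unfolding abs_divide using Ag aii[OF bM, of k] \<open>\<delta> > 0\<close> by (intro frac_le) auto
    also have "\<dots> = norm f / 2" using \<open>\<delta> > 0\<close> by simp
    finally show "\<bar>apply_c0 (\<rho> (A (\<iota> f)) - f) k\<bar> \<le> norm f / 2" .
  qed
  then obtain R where R: "bounded_linear R" "\<And>f. R (\<rho> (A (\<iota> f))) = f"
    using inverse_of_half_perturbation[of "\<lambda>f. \<rho> (A (\<iota> f))"]
      bounded_linear_compose[OF \<rho> bounded_linear_compose[OF A \<iota>]] by blast
  have "bounded_linear (\<lambda>f. V (\<iota> f))" "bounded_linear (\<lambda>x. R (\<rho> (W x)))"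
    by (intro bounded_linear_compose[OF V \<iota>]
        bounded_linear_compose[OF R(1) bounded_linear_compose[OF \<rho> W]])+
  moreover have "\<forall>f. R (\<rho> (W (V (\<iota> f)))) = f" using R(2) by (simp add: A_def)
  ultimately show ?thesis unfolding contains_complemented_copy_iff by blast
qed


section \<open>Pigeonhole principles below the cofinality\<close>

lemma UN_finite_ordLess:
  fixes A :: "'i \<Rightarrow> 'a set"
  assumes r: "Card_order r" "infinite (Field r)" and "finite I"
    and "\<And>i. i \<in> I \<Longrightarrow> |A i| <o r"
  shows "|\<Union>i\<in>I. A i| <o r"
  using assms(3,4)
proof (induction I rule: finite_induct)
  case empty
  have "|{} :: 'a set| <o r"
    using r(2) card_order_on_well_order_on[OF r(1)]
    by (intro finite_ordLess_infinite card_of_Well_order) (simp_all add: Field_card_of)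
  then show ?case by simp
next
  case (insert i I)
  then show ?case
    using card_of_Un_ordLess_infinite_Field[OF r(2,1), of "A i" "\<Union>i\<in>I. A i"] by simp
qed

lemma Times_ordLess:
  assumes r: "Card_order r" "infinite (Field r)" and A: "|A| <o r" and B: "|B| <o r"
  shows "|A \<times> B| <o r"
proof (cases "finite (A <+> B)")
  case True
  then have "finite (A \<times> B)" by simp
  then show ?thesis
    using r(2) card_order_on_well_order_on[OF r(1)]
    by (intro finite_ordLess_infinite card_of_Well_order) (simp_all add: Field_card_of)
next
  case False
  have "|A \<times> B| \<le>o |A <+> B|"
    using False
    by (intro card_of_Times_ordLeq_infinite_Field card_of_Plus1 card_of_Plus2 card_of_Card_order)
      (simp add: Field_card_of)
  then show ?thesis
    using card_of_Plus_ordLess_infinite_Field[OF r(2,1) A B] by (rule ordLeq_ordLess_trans)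
qed

text \<open>
  A well-order below \<open>r\<close> is isomorphic to a proper initial segment of \<open>r\<close>; this assigns to a set
  smaller than \<open>r\<close> an ordinal below \<open>r\<close>.
\<close>

lemma ordLess_imp_ordLeq_underS:
  assumes r: "Card_order r" and A: "|A| <o r"
  shows "\<exists>b\<in>Field r. |A| \<le>o |underS r b|"
proof -
  have W: "Well_order r" using r by (simp add: card_order_on_well_order_on)
  obtain b where b: "b \<in> Field r" "|A| =o Restr r (underS r b)"
    using ordLess_iff_ordIso_Restr[OF W card_of_Well_order] A by blast
  have "|A| \<le>o |Field (Restr r (underS r b))|"
    using card_of_mono2[OF ordIso_imp_ordLeq[OF b(2)]] by (simp add: Field_card_of)
  also have "|Field (Restr r (underS r b))| \<le>o |underS r b|"
    by (rule card_of_mono1) (auto simp: Field_def)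
  finally show ?thesis using b(1) by blast
qed

lemma bounded_below_cofinality:
  fixes r :: "'c rel"
  assumes r: "Card_order r" "infinite (Field r)"
    and I: "|I| <o cofinality r" and b: "\<And>i. i \<in> I \<Longrightarrow> b i \<in> Field r"
  shows "\<exists>a\<in>Field r. \<forall>i\<in>I. (b i, a) \<in> r"
proof (rule ccontr)
  assume "\<not> ?thesis"
  then have *: "\<And>a. a \<in> Field r \<Longrightarrow> \<exists>i\<in>I. (b i, a) \<notin> r" by blast
  have lin: "Linear_order r"
    using card_order_on_well_order_on[OF r(1)] unfolding well_order_on_def by blast
  have "\<exists>i\<in>I. a \<noteq> b i \<and> (a, b i) \<in> r" if "a \<in> Field r" for a
  proof -
    obtain i where i: "i \<in> I" "(b i, a) \<notin> r" using *[OF \<open>a \<in> Field r\<close>] by blast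
    have "(b i, b i) \<in> r"
      using lin b[OF i(1)] by (simp add: order_on_defs refl_on_def)
    with i(2) have "a \<noteq> b i" by auto
    moreover from this have "(a, b i) \<in> r"
      using lin b[OF i(1)] i(2) \<open>a \<in> Field r\<close> unfolding order_on_defs total_on_def by blast
    ultimately show ?thesis using i(1) by blast
  qed
  then have "BNF_Cardinal_Order_Relation.cofinal (b ` I) r"
    unfolding BNF_Cardinal_Order_Relation.cofinal_def by blast
  with b have "has_cofinal_family r |b ` I|"
    unfolding has_cofinal_family_def by (intro exI[of _ id]) (auto simp: Field_card_of)
  then have "cofinality r \<le>o |b ` I|"
    by (rule cofinality_least(3)[OF r card_of_Card_order])
  also have "|b ` I| \<le>o |I|" by (rule card_of_image)
  finally show False using I not_ordLess_ordLeq by blast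
qed

text \<open>
  The ordinals that bound the cardinalities of the \<open>A i\<close> are too few to be cofinal, so a single
  \<open>a\<close> below \<open>r\<close> bounds them all, and the union injects into \<open>I \<times> underS r a\<close>. It would not
  suffice to have \<open>I\<close> smaller than \<open>r\<close>: a singular \<open>r\<close> is a union of fewer than \<open>r\<close> smaller sets.
\<close>

lemma UN_below_cofinality_ordLess:
  fixes r :: "'c rel"
  assumes r: "Card_order r" "infinite (Field r)"
    and I: "|I| <o cofinality r" and A: "\<And>i. i \<in> I \<Longrightarrow> |A i| <o r"
  shows "|\<Union>i\<in>I. A i| <o r"
proof -
  have "\<forall>i\<in>I. \<exists>b\<in>Field r. |A i| \<le>o |underS r b|"
    using ordLess_imp_ordLeq_underS[OF r(1) A] by blast
  then obtain b where b: "\<And>i. i \<in> I \<Longrightarrow> b i \<in> Field r"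
      "\<And>i. i \<in> I \<Longrightarrow> |A i| \<le>o |underS r (b i)|"
    by metis
  obtain a where a: "a \<in> Field r" "\<And>i. i \<in> I \<Longrightarrow> (b i, a) \<in> r"
    using bounded_below_cofinality[OF r I, of b] b(1) by blast
  have "|A i| \<le>o |underS r a|" if "i \<in> I" for i
  proof -
    have "underS r (b i) \<subseteq> underS r a"
    proof (cases "b i = a")
      case False
      then show ?thesis
        using a(2)[OF that] Card_order_trans[OF r(1)] unfolding underS_def by blast
    qed simp
    then show ?thesis
      using b(2)[OF that] card_of_mono1 ordLeq_transitive by blast
  qed
  then have "|\<Union>i\<in>I. A i| \<le>o |I \<times> underS r a|"
    using card_of_UNION_Sigma card_of_Sigma_mono1[of I A "\<lambda>_. underS r a"]
    by (blast intro: ordLeq_transitive)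
  moreover have "|I| <o r"
  proof -
    have "has_cofinal_family r r"
      unfolding has_cofinal_family_def BNF_Cardinal_Order_Relation.cofinal_def
      using infinite_Card_order_limit[OF r] by (intro exI[of _ id]) auto
    then show ?thesis
      using I cofinality_least(3)[OF r r(1)] ordLess_ordLeq_trans by blast
  qed
  then have "|I \<times> underS r a| <o r"
    by (intro Times_ordLess[OF r] card_of_underS[OF r(1) a(1)])
  ultimately show ?thesis by (rule ordLeq_ordLess_trans)
qed

lemma large_fibre:
  fixes r :: "'c rel"
  assumes r: "Card_order r" "infinite (Field r)"
    and I: "finite I \<or> |I| <o cofinality r" and G: "|G| =o r" and h: "h ` G \<subseteq> I"
  obtains i where "i \<in> I" and "|{g \<in> G. h g = i}| =o r"
proof -
  let ?A = "\<lambda>i. {g \<in> G. h g = i}"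
  have "\<exists>i\<in>I. \<not> |?A i| <o r"
  proof (rule ccontr)
    assume "\<not> ?thesis"
    then have small: "\<And>i. i \<in> I \<Longrightarrow> |?A i| <o r" by simp
    from I have "|\<Union>i\<in>I. ?A i| <o r"
    proof
      assume "finite I"
      then show ?thesis by (rule UN_finite_ordLess[OF r _ small])
    next
      assume "|I| <o cofinality r"
      then show ?thesis by (rule UN_below_cofinality_ordLess[OF r _ small])
    qed
    moreover have "(\<Union>i\<in>I. ?A i) = G" using h by blast
    ultimately have "|G| <o r" by simp
    then show False using G not_ordLess_ordIso by blast
  qed
  then obtain i where i: "i \<in> I" "\<not> |?A i| <o r" by blast
  have "|?A i| \<le>o |G|" by (rule card_of_mono1) auto
  then have "|?A i| \<le>o r" using G by (rule ordLeq_ordIso_trans)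
  with i show thesis using that ordLeq_iff_ordLess_or_ordIso by blast
qed

text \<open>
  By induction on \<open>n\<close>, the \<open>n\<close>-element subsets of an infinite set \<open>B\<close> are at most as many as the
  elements of \<open>B\<close>, and there are only countably many \<open>n\<close>.
\<close>

lemma Fpow_ordLeq:
  assumes "infinite B"
  shows "|Fpow B| \<le>o |B|"
proof -
  let ?F = "\<lambda>n. {X. X \<subseteq> B \<and> finite X \<and> card X = n}"
  have "|?F n| \<le>o |B|" for n
  proof (induction n)
    case 0
    have "B \<noteq> {}" using assms by auto
    have "?F 0 = {{}}" by auto
    then show ?case using card_of_singl_ordLeq[OF \<open>B \<noteq> {}\<close>] by simp
  next
    case (Suc n)
    have "?F (Suc n) \<subseteq> (\<Union>b\<in>B. insert b ` ?F n)"
    proof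
      fix X assume "X \<in> ?F (Suc n)"
      then obtain b Y where "X = insert b Y" "b \<notin> Y" "card Y = n" "X \<subseteq> B" "finite Y"
        by (force simp: card_Suc_eq)
      then show "X \<in> (\<Union>b\<in>B. insert b ` ?F n)" by auto
    qed
    then have "|?F (Suc n)| \<le>o |\<Union>b\<in>B. insert b ` ?F n|" by (rule card_of_mono1)
    also have "|\<Union>b\<in>B. insert b ` ?F n| \<le>o |B|"
    proof (rule card_of_UNION_ordLeq_infinite[OF assms])
      show "\<forall>b\<in>B. |insert b ` ?F n| \<le>o |B|"
        by (rule ballI, rule ordLeq_transitive[OF card_of_image Suc])
    qed (rule ordLeq_refl[OF card_of_Card_order])
    finally show ?case .
  qed
  moreover have "|UNIV :: nat set| \<le>o |B|"
    using assms infinite_iff_card_of_nat by blast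
  ultimately have "|\<Union>n. ?F n| \<le>o |B|"
    by (intro card_of_UNION_ordLeq_infinite[OF assms]) auto
  moreover have "Fpow B = (\<Union>n. ?F n)" by (auto simp: Fpow_def)
  ultimately show ?thesis by simp
qed

section \<open>Vector-valued continuous functions on a compact space\<close>

lemma bounded_linear_apply_bcontfun: "bounded_linear (\<lambda>f. apply_bcontfun f t)"
  by (rule bounded_linear_intro[of _ 1]) (simp_all add: norm_bounded)

text \<open>
  The operator \<open>x \<mapsto> p \<otimes> x\<close>. The pieces \<open>p\<^sub>t\<close> of a partition of unity use it to carry values in \<open>X\<close> back
  to functions; \<open>p = 1\<close> gives the constant functions.
\<close>

lemma scalar_times_vector_bcontfun:
  fixes p :: "'k::topological_space \<Rightarrow> real"
  assumes K: "compact (UNIV :: 'k set)" and p: "continuous_on UNIV p"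
  obtains J :: "'x::real_normed_vector \<Rightarrow> ('k \<Rightarrow>\<^sub>C 'x)"
  where "bounded_linear J" and "\<And>x s. apply_bcontfun (J x) s = p s *\<^sub>R x"
proof -
  define J :: "'x \<Rightarrow> ('k \<Rightarrow>\<^sub>C 'x)" where "J x = Bcontfun (\<lambda>s. p s *\<^sub>R x)" for x
  have J: "apply_bcontfun (J x) s = p s *\<^sub>R x" for x s
  proof -
    have "(\<lambda>s. p s *\<^sub>R x) \<in> bcontfun"
      by (intro continuous_imp_bcontfun K continuous_intros p)
    then show ?thesis by (simp add: J_def Bcontfun_inverse)
  qed
  have "bounded (range p)"
    by (rule compact_imp_bounded[OF compact_continuous_image[OF p K]])
  then obtain C where C: "\<And>s. \<bar>p s\<bar> \<le> C" unfolding bounded_iff by auto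
  have "bounded_linear J"
  proof (rule bounded_linear_intro[of _ C])
    show "norm (J x) \<le> norm x * C" for x
    proof (rule norm_bound)
      show "norm (apply_bcontfun (J x) s) \<le> norm x * C" for s
        using mult_right_mono[OF C[of s] norm_ge_zero[of x]] by (simp add: J mult.commute)
    qed
  qed (auto intro!: bcontfun_eqI simp: J algebra_simps)
  with J show thesis using that by blast
qed

lemma compact_t2_bump:
  assumes "compact (UNIV :: 'k::t2_space set)" and "open U" and "t \<in> U"
  shows "\<exists>g :: 'k \<Rightarrow> real. continuous_on UNIV g \<and> (\<forall>s. 0 \<le> g s) \<and> g t = 1 \<and> (\<forall>s. s \<notin> U \<longrightarrow> g s = 0)"
proof -
  have "compact_space (euclidean :: 'k topology)"
    using assms(1) by (simp add: compact_space_def)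
  moreover have "Hausdorff_space (euclidean :: 'k topology)"
    unfolding Hausdorff_space_def disjnt_def using hausdorff by (auto simp: open_openin[symmetric])
  ultimately have "normal_space (euclidean :: 'k topology)"
    by (blast intro: compact_Hausdorff_or_regular_imp_normal_space)
  moreover have "closedin euclidean (- U)" "closedin euclidean {t}" "disjnt (- U) {t}"
    using assms(2,3) by (auto simp: closed_closedin[symmetric] disjnt_def)
  ultimately obtain g where g: "continuous_map euclidean (top_of_set {0..1::real}) g"
    "g ` (- U) \<subseteq> {0}" "g ` {t} \<subseteq> {1}"
    using Urysohn_lemma[of euclidean "- U" "{t}" 0 1] by auto
  then have "continuous_on UNIV g" "range g \<subseteq> {0..1}"
    by (auto simp: continuous_map_in_subtopology)
  moreover from this(2) have "0 \<le> g s" for s by (auto simp: image_subset_iff)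
  ultimately show ?thesis using g(2,3) by (intro exI[of _ g]) auto
qed

text \<open>
  Every point \<open>t\<close> gets a bump \<open>g\<^sub>t\<close> that equals \<open>1\<close> at \<open>t\<close> and lives inside a member of the cover that
  contains \<open>t\<close>. Finitely many of the sets \<open>{g\<^sub>t > 0}\<close> cover the space, and dividing by the sum of these
  bumps normalises them. Indexing the functions by points rather than by members of the cover provides
  the point at which a function is sampled in the approximation below.
\<close>

lemma partition_of_unity_at_points:
  fixes F :: "'k::t2_space set set"
  assumes K: "compact (UNIV :: 'k set)"
    and op: "\<And>U. U \<in> F \<Longrightarrow> open U" and cover: "\<Union>F = UNIV"
  obtains N :: "'k set" and p :: "'k \<Rightarrow> 'k \<Rightarrow> real"
  where "finite N" and "\<And>t. continuous_on UNIV (p t)" and "\<And>t s. 0 \<le> p t s"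
    and "\<And>s. (\<Sum>t\<in>N. p t s) = 1"
    and "\<And>t. \<exists>U\<in>F. t \<in> U \<and> (\<forall>s. s \<notin> U \<longrightarrow> p t s = 0)"
proof -
  have "\<forall>t. \<exists>g. continuous_on UNIV g \<and> (\<forall>s. 0 \<le> (g s :: real)) \<and> g t = 1 \<and>
      (\<exists>U\<in>F. t \<in> U \<and> (\<forall>s. s \<notin> U \<longrightarrow> g s = 0))"
  proof
    fix t
    have "t \<in> \<Union>F" using cover by simp
    then obtain U where U: "U \<in> F" "t \<in> U" by blast
    from compact_t2_bump[OF K op[OF U(1)] U(2)] U
    show "\<exists>g. continuous_on UNIV g \<and> (\<forall>s. 0 \<le> (g s :: real)) \<and> g t = 1 \<and>
      (\<exists>U\<in>F. t \<in> U \<and> (\<forall>s. s \<notin> U \<longrightarrow> g s = 0))" by blast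
  qed
  from choice[OF this] obtain g :: "'k \<Rightarrow> 'k \<Rightarrow> real"
    where g: "\<forall>t. continuous_on UNIV (g t) \<and> (\<forall>s. 0 \<le> g t s) \<and> g t t = 1 \<and>
      (\<exists>U\<in>F. t \<in> U \<and> (\<forall>s. s \<notin> U \<longrightarrow> g t s = 0))" ..
  have cont: "continuous_on UNIV (g t)" and pos: "0 \<le> g t s" and one: "g t t = 1"
    and supp: "\<exists>U\<in>F. t \<in> U \<and> (\<forall>s. s \<notin> U \<longrightarrow> g t s = 0)" for t s
    using spec[OF g, of t] by simp_all
  have "open {s. 0 < g t s}" for t
    using open_Collect_less[OF continuous_on_const cont] .
  moreover have "UNIV \<subseteq> (\<Union>t. {s. 0 < g t s})"
  proof
    show "s \<in> (\<Union>t. {s. 0 < g t s})" for s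
      by (rule UN_I[of s]) (simp_all add: one)
  qed
  ultimately obtain N where N: "finite N" "UNIV \<subseteq> (\<Union>t\<in>N. {s. 0 < g t s})"
    using compactE_image[OF K, of UNIV "\<lambda>t. {s. 0 < g t s}"] by auto
  define S where "S s = (\<Sum>t\<in>N. g t s)" for s
  have S: "S s > 0" for s
  proof -
    obtain t where "t \<in> N" "0 < g t s" using N(2) by blast
    then show ?thesis unfolding S_def using N(1) pos by (intro sum_pos2[of N t]) auto
  qed
  show thesis
  proof (rule that[of N "\<lambda>t s. g t s / S s"])
    show "continuous_on UNIV (\<lambda>s. g t s / S s)" for t
    proof (intro continuous_on_divide cont)
      show "continuous_on UNIV S"
        unfolding S_def by (intro continuous_on_sum cont)
      show "\<forall>s\<in>UNIV. S s \<noteq> 0" using S by (simp add: less_imp_neq[symmetric])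
    qed
    show "0 \<le> g t s / S s" for t s using pos S[of s] by simp
    show "(\<Sum>t\<in>N. g t s / S s) = 1" for s
      using S[of s] by (simp add: S_def flip: sum_divide_distrib)
    show "\<exists>U\<in>F. t \<in> U \<and> (\<forall>s. s \<notin> U \<longrightarrow> g t s / S s = 0)" for t
    proof -
      obtain U where "U \<in> F" "t \<in> U" "\<And>s. s \<notin> U \<Longrightarrow> g t s = 0" using supp[of t] by blast
      then show ?thesis by (intro bexI[of _ U]) auto
    qed
  qed (rule N(1))
qed

lemma small_oscillation_cover:
  fixes f :: "'k::topological_space \<Rightarrow>\<^sub>C 'x::real_normed_vector"
  assumes K: "compact (UNIV :: 'k set)" and B: "topological_basis B" and "e > 0"
  shows "\<exists>F\<in>Fpow B. \<Union>F = UNIV \<and> (\<forall>U\<in>F. \<forall>s\<in>U. \<forall>t\<in>U. norm (f s - f t) \<le> e)"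
proof -
  let ?C = "{U \<in> B. \<forall>s\<in>U. \<forall>t\<in>U. norm (f s - f t) \<le> e}"
  have "t \<in> \<Union>?C" for t
  proof -
    have "open (apply_bcontfun f -` ball (f t) (e/2))"
      by (intro open_vimage continuous_on_apply_bcontfun open_ball)
    moreover have "t \<in> apply_bcontfun f -` ball (f t) (e/2)" using \<open>e > 0\<close> by simp
    ultimately obtain U where U: "U \<in> B" "t \<in> U" "U \<subseteq> apply_bcontfun f -` ball (f t) (e/2)"
      using topological_basisE[OF B] by blast
    have "norm (f s - f s') \<le> e" if "s \<in> U" "s' \<in> U" for s s'
    proof -
      have "dist (f t) (f s) < e/2" "dist (f t) (f s') < e/2" using U(3) that by auto
      then have "dist (f s) (f s') < e" by (rule dist_triangle_half_r)
      then show ?thesis by (simp add: dist_norm)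
    qed
    with U show ?thesis by blast
  qed
  then have "UNIV \<subseteq> \<Union>?C" by blast
  moreover have "open U" if "U \<in> ?C" for U
    using that topological_basis_open[OF B] by blast
  ultimately obtain F where F: "F \<subseteq> ?C" "finite F" "UNIV \<subseteq> \<Union>F"
    by (rule compactE[OF K])
  then have "F \<in> Fpow B" "\<Union>F = UNIV" by (auto simp: Fpow_def)
  moreover have "\<forall>U\<in>F. \<forall>s\<in>U. \<forall>t\<in>U. norm (f s - f t) \<le> e"
    using F(1) by (auto dest: subsetD)
  ultimately show ?thesis by blast
qed

text \<open>
  At \<open>s\<close>, the difference is the average of the vectors \<open>f s - f t\<close> with weights \<open>p t s\<close>, and a weight is
  non-zero only if \<open>s\<close> and \<open>t\<close> lie in a common member of the cover.
\<close>

lemma partition_of_unity_approximation: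
  fixes f :: "'k::topological_space \<Rightarrow>\<^sub>C 'x::real_normed_vector"
    and J :: "'k \<Rightarrow> 'x \<Rightarrow> ('k \<Rightarrow>\<^sub>C 'x)"
  assumes pos: "\<And>t s. 0 \<le> p t s" and one: "\<And>s. (\<Sum>t\<in>N. p t s) = 1"
    and supp: "\<And>t. \<exists>U\<in>F. t \<in> U \<and> (\<forall>s. s \<notin> U \<longrightarrow> p t s = 0)"
    and osc: "\<forall>U\<in>F. \<forall>s\<in>U. \<forall>t\<in>U. norm (f s - f t) \<le> e"
    and J: "\<And>t x s. apply_bcontfun (J t x) s = p t s *\<^sub>R x"
  shows "norm (f - (\<Sum>t\<in>N. J t (f t))) \<le> e"
proof (rule norm_bound)
  fix s
  have "linear (\<lambda>f :: 'k \<Rightarrow>\<^sub>C 'x. apply_bcontfun f s)"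
    by (rule bounded_linear.linear[OF bounded_linear_apply_bcontfun])
  from linear_sum[OF this, of "\<lambda>t. J t (f t)" N]
  have sum: "apply_bcontfun (\<Sum>t\<in>N. J t (f t)) s = (\<Sum>t\<in>N. p t s *\<^sub>R f t)"
    by (simp add: J)
  have "apply_bcontfun (f - (\<Sum>t\<in>N. J t (f t))) s = (\<Sum>t\<in>N. p t s) *\<^sub>R f s - (\<Sum>t\<in>N. p t s *\<^sub>R f t)"
    by (simp add: sum one)
  also have "\<dots> = (\<Sum>t\<in>N. p t s *\<^sub>R (f s - f t))"
    by (simp add: scaleR_sum_left scaleR_diff_right sum_subtractf)
  also have "norm \<dots> \<le> (\<Sum>t\<in>N. p t s * e)"
  proof (rule order_trans[OF norm_sum sum_mono])
    fix t
    obtain U where U: "U \<in> F" "t \<in> U" "s \<notin> U \<Longrightarrow> p t s = 0" using supp[of t] by blast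
    show "norm (p t s *\<^sub>R (f s - f t)) \<le> p t s * e"
    proof (cases "s \<in> U")
      case True
      then have "norm (f s - f t) \<le> e" using osc U by blast
      then show ?thesis using pos[of t s] by (simp add: mult_left_mono)
    qed (simp add: U)
  qed
  also have "\<dots> = e" using one[of s] by (simp flip: sum_distrib_right)
  finally show "norm (apply_bcontfun (f - (\<Sum>t\<in>N. J t (f t))) s) \<le> e" .
qed

lemma exists_large_term:
  fixes c :: "'a \<Rightarrow> real"
  assumes "\<bar>\<Sum>t\<in>N. c t\<bar> \<ge> d" and "d > 0"
  shows "\<exists>t\<in>N. d / real (card N) \<le> \<bar>c t\<bar>"
proof (rule ccontr)
  assume "\<not> ?thesis"
  then have less: "\<bar>c t\<bar> < d / real (card N)" if "t \<in> N" for t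
    using that by (simp add: not_le)
  have "finite N" "N \<noteq> {}" using assms by (auto intro: ccontr)
  then have "(\<Sum>t\<in>N. \<bar>c t\<bar>) < (\<Sum>t\<in>N. d / real (card N))"
    by (intro sum_strict_mono less)
  also have "\<dots> = d" using \<open>finite N\<close> \<open>N \<noteq> {}\<close> by simp
  finally show False using assms(1) sum_abs[of c N] by linarith
qed

section \<open>Complemented copies in \<open>C(K,X)\<close> and in \<open>X\<close>\<close>

lemma copy_in_functions_if_copy_in_values:
  assumes K: "compact (UNIV :: 'k::topological_space set)"
    and X: "contains_complemented_copy TYPE('x::real_normed_vector) TYPE('z::real_normed_vector)"
  shows "contains_complemented_copy TYPE('k \<Rightarrow>\<^sub>C 'x) TYPE('z)"
proof -
  obtain T :: "'z \<Rightarrow> 'x" and Q where T: "bounded_linear T" and Q: "bounded_linear Q"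
    and QT: "\<And>z. Q (T z) = z"
    using X unfolding contains_complemented_copy_iff by blast
  \<comment> \<open>The constant functions embed \<open>X\<close>, and the evaluation at any point inverts this embedding.\<close>
  have "continuous_on UNIV (\<lambda>_ :: 'k. 1 :: real)" by simp
  then obtain J :: "'x \<Rightarrow> ('k \<Rightarrow>\<^sub>C 'x)" where J: "bounded_linear J"
    and apply_J: "\<And>x s. apply_bcontfun (J x) s = 1 *\<^sub>R x"
    by (rule scalar_times_vector_bcontfun[OF K]) (rule that)
  have "bounded_linear (\<lambda>z. J (T z))"
    by (rule bounded_linear_compose[OF J T])
  moreover have "bounded_linear (\<lambda>f :: 'k \<Rightarrow>\<^sub>C 'x. Q (apply_bcontfun f undefined))"
    by (rule bounded_linear_compose[OF Q bounded_linear_apply_bcontfun])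
  ultimately show ?thesis
    unfolding contains_complemented_copy_iff using apply_J QT by fastforce
qed

text \<open>
  Two pigeonhole arguments fix first the finite cover, hence the partition of unity, and then the
  point \<open>t\<close> of the partition, without losing cardinality of the set of indices. Composing the given
  factorisation with the evaluation at \<open>t\<close> and with \<open>x \<mapsto> p\<^sub>t \<otimes> x\<close> gives operators through \<open>X\<close> with a
  large diagonal.
\<close>

lemma copy_in_values_if_copy_in_functions:
  fixes \<tau> :: "'t rel"
  assumes K: "compact (UNIV :: 'k::t2_space set)"
    and \<tau>: "Card_order \<tau>" "infinite (Field \<tau>)"
    and g: "|UNIV :: 'g set| =o \<tau>"
    and w: "weight TYPE('k) <o cofinality \<tau>"
    and C: "contains_complemented_copy TYPE('k \<Rightarrow>\<^sub>C 'x::real_normed_vector) TYPE('g c0)"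
  shows "contains_complemented_copy TYPE('x) TYPE('g c0)"
proof -
  obtain T :: "'g c0 \<Rightarrow> ('k \<Rightarrow>\<^sub>C 'x)" and Q where T: "bounded_linear T" and Q: "bounded_linear Q"
    and QT: "\<And>z. Q (T z) = z"
    using C unfolding contains_complemented_copy_iff by blast
  interpret Q: bounded_linear Q by fact
  have "onorm Q \<ge> 0" by (rule onorm_pos_le[OF Q])
  have inf: "infinite A" if "|A| =o \<tau>" for A :: "'g set"
    using card_of_ordIso_finite_Field[OF \<tau>(1) ordIso_symmetric[OF that]] \<tau>(2) by simp
  \<comment> \<open>With this \<open>e\<close>, an approximation within \<open>e\<close> changes a coordinate of the image under \<open>Q\<close> by at
    most \<open>1/2\<close>, whereas the relevant coordinate is \<open>1\<close>. The summand \<open>1\<close> keeps the denominator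
    positive.\<close>
  define e where "e = 1 / (2 * (onorm Q + 1))"
  have "e > 0" and Qe: "onorm Q * e \<le> 1 / 2"
    using \<open>onorm Q \<ge> 0\<close> by (simp_all add: e_def field_simps)
  obtain B :: "'k set set" where B: "topological_basis B" and "weight TYPE('k) = |B|"
    using weight_least(1) by blast
  have small: "finite (Fpow B) \<or> |Fpow B| <o cofinality \<tau>"
  proof (cases "finite B")
    case False
    then show ?thesis
      using Fpow_ordLeq[OF False] w \<open>weight TYPE('k) = |B|\<close> ordLeq_ordLess_trans by metis
  qed (simp add: Fpow_def)
  define adapted where "adapted f F \<longleftrightarrow> F \<in> Fpow B \<and> \<Union>F = UNIV \<and>
      (\<forall>U\<in>F. \<forall>s\<in>U. \<forall>t\<in>U. norm (apply_bcontfun f s - apply_bcontfun f t) \<le> e)"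
    for f :: "'k \<Rightarrow>\<^sub>C 'x" and F
  have "\<forall>i. \<exists>F. adapted (T (unit_c0 i)) F"
    using small_oscillation_cover[OF K B \<open>e > 0\<close>] unfolding adapted_def Bex_def ..
  from choice[OF this] obtain h where h: "\<forall>i. adapted (T (unit_c0 i)) (h i)" ..
  then have "h ` UNIV \<subseteq> Fpow B" by (auto simp: adapted_def)
  from large_fibre[OF \<tau> small g this] obtain F
    where "F \<in> Fpow B" and G: "|{i \<in> UNIV. h i = F}| =o \<tau>" .
  define G where "G = {i \<in> UNIV. h i = F}"
  have F: "adapted (T (unit_c0 i)) F" if "i \<in> G" for i
    using h that by (auto simp: G_def)
  have "G \<noteq> {}"
    unfolding G_def by (rule infinite_imp_nonempty[OF inf[OF G]])
  then have cover: "\<Union>F = UNIV" using F by (auto simp: adapted_def)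
  have op: "open U" if "U \<in> F" for U
    using that \<open>F \<in> Fpow B\<close> topological_basis_open[OF B] by (auto simp: Fpow_def)
  obtain N :: "'k set" and p :: "'k \<Rightarrow> 'k \<Rightarrow> real"
    where N: "finite N" and p: "\<And>t. continuous_on UNIV (p t)" "\<And>t s. 0 \<le> p t s"
      "\<And>s. (\<Sum>t\<in>N. p t s) = 1" "\<And>t. \<exists>U\<in>F. t \<in> U \<and> (\<forall>s. s \<notin> U \<longrightarrow> p t s = 0)"
    by (rule partition_of_unity_at_points[OF K op cover]) (assumption, rule that)
  have "\<exists>J :: 'x \<Rightarrow> ('k \<Rightarrow>\<^sub>C 'x). bounded_linear J \<and> (\<forall>x s. apply_bcontfun (J x) s = p t s *\<^sub>R x)" for t
    by (rule scalar_times_vector_bcontfun[OF K p(1)[of t]]) blast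
  then have "\<forall>t. \<exists>J :: 'x \<Rightarrow> ('k \<Rightarrow>\<^sub>C 'x). bounded_linear J \<and> (\<forall>x s. apply_bcontfun (J x) s = p t s *\<^sub>R x)" ..
  from choice[OF this] obtain J :: "'k \<Rightarrow> 'x \<Rightarrow> ('k \<Rightarrow>\<^sub>C 'x)"
    where "\<forall>t. bounded_linear (J t) \<and> (\<forall>x s. apply_bcontfun (J t x) s = p t s *\<^sub>R x)" ..
  then have J: "bounded_linear (J t)" and apply_J: "apply_bcontfun (J t x) s = p t s *\<^sub>R x" for t x s
    by simp_all
  let ?c = "\<lambda>i t. apply_c0 (Q (J t (apply_bcontfun (T (unit_c0 i)) t))) i"
  have "\<exists>t\<in>N. (1/2) / real (card N) \<le> \<bar>?c i t\<bar>" if "i \<in> G" for i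
  proof (rule exists_large_term)
    let ?f = "T (unit_c0 i)"
    let ?s = "\<Sum>t\<in>N. J t (apply_bcontfun ?f t)"
    have "norm (?f - ?s) \<le> e"
      using F[OF that] unfolding adapted_def
      by (intro partition_of_unity_approximation[OF p(2,3,4) _ apply_J]) blast
    then have "onorm Q * norm (?f - ?s) \<le> onorm Q * e"
      using \<open>onorm Q \<ge> 0\<close> by (rule mult_left_mono)
    with Qe have "\<bar>apply_c0 (Q (?f - ?s)) i\<bar> \<le> 1 / 2"
      using abs_apply_c0_le[of "Q (?f - ?s)" i] onorm[OF Q, of "?f - ?s"] by linarith
    moreover have "apply_c0 (Q (?f - ?s)) i = 1 - (\<Sum>t\<in>N. ?c i t)"
      by (simp add: Q.diff Q.sum QT minus_c0.rep_eq unit_c0.rep_eq apply_c0_sum)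
    ultimately show "1 / 2 \<le> \<bar>\<Sum>t\<in>N. ?c i t\<bar>" by linarith
  qed simp
  then have "\<forall>i\<in>G. \<exists>t. t \<in> N \<and> (1/2) / real (card N) \<le> \<bar>?c i t\<bar>" by blast
  from bchoice[OF this] obtain h'
    where h': "\<forall>i\<in>G. h' i \<in> N \<and> (1/2) / real (card N) \<le> \<bar>?c i (h' i)\<bar>" ..
  then have "h' ` G \<subseteq> N" by blast
  from large_fibre[OF \<tau> disjI1[OF N] G[folded G_def] this] obtain t
    where "t \<in> N" and G': "|{i \<in> G. h' i = t}| =o \<tau>" .
  show ?thesis
  proof (rule complemented_copy_from_large_diagonal)
    show "bounded_linear (\<lambda>z. apply_bcontfun (T z) t)"
      by (rule bounded_linear_compose[OF bounded_linear_apply_bcontfun T])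
    show "bounded_linear (\<lambda>x. Q (J t x))"
      by (rule bounded_linear_compose[OF Q J])
    show "infinite (UNIV :: 'g set)"
      by (rule inf[OF g])
    show "|{i \<in> G. h' i = t}| =o |UNIV :: 'g set|"
      using G' ordIso_symmetric[OF g] by (rule ordIso_transitive)
    show "0 < (1/2) / real (card N)"
      using \<open>t \<in> N\<close> N by (simp add: card_gt_0_iff) auto
    show "(1/2) / real (card N) \<le> \<bar>apply_c0 (Q (J t (apply_bcontfun (T (unit_c0 i)) t))) i\<bar>"
      if "i \<in> {i \<in> G. h' i = t}" for i
      using h' that by auto
  qed
qed

theorem theorem1p2:
  fixes \<tau> :: "'t rel"
  assumes "compact (UNIV :: 'k::t2_space set)"
    and "Card_order \<tau>" and "infinite (Field \<tau>)"
    and "|UNIV :: 'g set| =o \<tau>"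
    and "weight TYPE('k) <o cofinality \<tau>"
  shows "contains_complemented_copy TYPE('k \<Rightarrow>\<^sub>C 'x::banach) TYPE('g c0) \<longleftrightarrow>
         contains_complemented_copy TYPE('x) TYPE('g c0)"
  using copy_in_values_if_copy_in_functions[OF assms] copy_in_functions_if_copy_in_values[OF assms(1)]
  by blast

end
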